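(* Let $F\colon G\to\mathbf{R}_{\geq 0}$ be a function of real hyperbolic type on a group $G$. Suppose that the ratio $F/F'$ is unbounded on $G$ for every function of real hyperbolic type $F'\colon G\to\mathbf{R}_{\geq 0}$ with $F'\leq F$ and $F'\neq F$. Then the representation corresponding to $F$ is irreducible.
   Context: For a real Hilbert space $H$ of Hilbertian dimension $\kappa$ (any cardinal), let $B(z\oplus u,w\oplus v)=zw-\langle u,v\rangle$ on $\mathbf{R}\oplus H$. The real hyperbolic space $\mathbf{H}_{\mathbf{R}}^\kappa$ is the projectivisation of the set of $B$-positive vectors, with $\cosh d(x,y)=|B(X,Y)|/(B(X,X)B(Y,Y))^{1/2}$ for representatives $X,Y$. A subset is total if it is contained in no proper real hyperbolic subspace. A symmetric function $\beta\colon X\times X\to\mathbf{R}_{\geq 0}$ with value $1$ on the diagonal is a kernel of real hyperbolic type on the set $X$ if for every (equivalently some) $x_0\in X$ one has $\sum_{j,k}c_jc_k\big(\beta(x_j,x_0)\beta(x_0,x_k)-\beta(x_j,x_k)\big)\geq 0$ for all finite families $c_j\in\mathbf{R}$, $x_j\in X$. A function of real hyperbolic type on a group $G$ is a function $F\colon G\to\mathbf{R}_{\geq 0}$ such that $(g,h)\mapsto F(g^{-1}h)$ is a kernel of real hyperbolic type on $G$. The representation corresponding to $F$: there are a cardinal $\kappa$, an isometric $G$-action on $\mathbf{H}_{\mathbf{R}}^\kappa$ and a point $p\in\mathbf{H}_{\mathbf{R}}^\kappa$ with total orbit $Gp$ such that $F(g)=\cosh d(gp,p)$ for all $g\in G$;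 this is unique up to isometry. Irreducible: when $\kappa\geq 2$, the action is irreducible if the associated projective representation on $\mathbf{R}\oplus H$ (through $\mathrm{Is}(\mathbf{H}_{\mathbf{R}}^\kappa)\cong\mathbf{PO}(B)$) has no closed invariant linear subspace other than $0$ and the whole space; equivalently, $G$ preserves no non-empty finite subset of $\mathbf{H}_{\mathbf{R}}^\kappa\cup\partial\mathbf{H}_{\mathbf{R}}^\kappa$ and every $G$-orbit is total. The degenerate cases $\kappa=0$ and $\kappa=1$ are allowed; there irreducible is understood as the absence of a proper (non-empty) $G$-invariant real hyperbolic subspace. *)

theory Defs
  imports "HOL-Analysis.Analysis" "HOL-Algebra.Group_Action"
begin

section \<open>Real hyperbolic space over a real Hilbert space\<close>

text \<open>
  A real Hilbert space \<open>H\<close> is a type of sort \<open>{real_inner, complete_space}\<close>; its Hilbertian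
  dimension is arbitrary (finite or infinite, possibly \<open>0\<close>), and \<open>\<real> \<oplus> H\<close> is the product type.
\<close>

definition lorentz_form :: "real \<times> 'h::real_inner \<Rightarrow> real \<times> 'h \<Rightarrow> real" where
  "lorentz_form x y = fst x * fst y - inner (snd x) (snd y)"

text \<open>Points of the projectivisation are represented as one-dimensional linear subspaces.\<close>

definition hyperbolic_space :: "(real \<times> 'h::real_inner) set set" where
  "hyperbolic_space = {span {v} | v. lorentz_form v v > 0}"

definition hyperbolic_dist :: "(real \<times> 'h::real_inner) set \<Rightarrow> (real \<times> 'h) set \<Rightarrow> real" where
  "hyperbolic_dist x y = (THE d. d \<ge> 0 \<and> (\<forall>X \<in> x - {0}. \<forall>Y \<in> y - {0}.
     cosh d = \<bar>lorentz_form X Y\<bar> / sqrt (lorentz_form X X * lorentz_form Y Y)))"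

definition hyperbolic_subspace :: "(real \<times> 'h::real_inner) set set \<Rightarrow> bool" where
  "hyperbolic_subspace S \<longleftrightarrow> S \<noteq> {} \<and>
     (\<exists>V. subspace V \<and> closed V \<and> S = {x \<in> hyperbolic_space. x \<subseteq> V})"

definition total_subset :: "(real \<times> 'h::real_inner) set set \<Rightarrow> bool" where
  "total_subset A \<longleftrightarrow> A \<subseteq> hyperbolic_space \<and>
     \<not> (\<exists>S. hyperbolic_subspace S \<and> S \<noteq> hyperbolic_space \<and> A \<subseteq> S)"

section \<open>Kernels and functions of real hyperbolic type\<close>

definition real_hyperbolic_kernel :: "'x set \<Rightarrow> ('x \<Rightarrow> 'x \<Rightarrow> real) \<Rightarrow> bool" where
  "real_hyperbolic_kernel X \<beta> \<longleftrightarrow>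
     (\<forall>x\<in>X. \<forall>y\<in>X. \<beta> x y \<ge> 0 \<and> \<beta> x y = \<beta> y x) \<and>
     (\<forall>x\<in>X. \<beta> x x = 1) \<and>
     (\<forall>x0\<in>X. \<forall>(n::nat) (c :: nat \<Rightarrow> real) x. (\<forall>j<n. x j \<in> X) \<longrightarrow>
        (\<Sum>j<n. \<Sum>k<n. c j * c k * (\<beta> (x j) x0 * \<beta> x0 (x k) - \<beta> (x j) (x k))) \<ge> 0)"

definition real_hyperbolic_function :: "('g, 'm) monoid_scheme \<Rightarrow> ('g \<Rightarrow> real) \<Rightarrow> bool" where
  "real_hyperbolic_function G F \<longleftrightarrow>
     real_hyperbolic_kernel (carrier G) (\<lambda>g h. F (inv\<^bsub>G\<^esub> g \<otimes>\<^bsub>G\<^esub> h))"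

section \<open>Isometric actions and irreducibility\<close>

definition isometric_action ::
  "('g, 'm) monoid_scheme \<Rightarrow> ('g \<Rightarrow> (real \<times> 'h::real_inner) set \<Rightarrow> (real \<times> 'h) set) \<Rightarrow> bool" where
  "isometric_action G \<phi> \<longleftrightarrow> group_action G hyperbolic_space \<phi> \<and>
     (\<forall>g \<in> carrier G. \<forall>x \<in> hyperbolic_space. \<forall>y \<in> hyperbolic_space.
        hyperbolic_dist (\<phi> g x) (\<phi> g y) = hyperbolic_dist x y)"

text \<open>
  \<open>G\<close> acting via \<open>\<phi>\<close>, together with the base point \<open>p\<close>, is the (unique up to isometry)
  representation corresponding to \<open>F\<close>.
\<close>

definition corresponding_representation ::
  "('g, 'm) monoid_scheme \<Rightarrow> ('g \<Rightarrow> real) \<Rightarrow>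
   ('g \<Rightarrow> (real \<times> 'h::real_inner) set \<Rightarrow> (real \<times> 'h) set) \<Rightarrow> (real \<times> 'h) set \<Rightarrow> bool" where
  "corresponding_representation G F \<phi> p \<longleftrightarrow>
     isometric_action G \<phi> \<and> p \<in> hyperbolic_space \<and> total_subset (orbit G \<phi> p) \<and>
     (\<forall>g \<in> carrier G. F g = cosh (hyperbolic_dist (\<phi> g p) p))"

definition lorentz_group :: "(real \<times> 'h::real_inner \<Rightarrow> real \<times> 'h) set" where
  "lorentz_group = {T. linear T \<and> bij T \<and> (\<forall>x y. lorentz_form (T x) (T y) = lorentz_form x y)}"

text \<open>
  The class \<open>{T, -T}\<close> in \<open>PO(B)\<close> corresponding to an isometry \<open>f\<close> of hyperbolic space; see
  \<open>lorentz_lifts_isometry\<close> below for existence and uniqueness of \<open>T\<close> up to sign.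
\<close>

definition lorentz_lifts ::
  "((real \<times> 'h::real_inner) set \<Rightarrow> (real \<times> 'h) set) \<Rightarrow> (real \<times> 'h \<Rightarrow> real \<times> 'h) set" where
  "lorentz_lifts f = {T \<in> lorentz_group. \<forall>x \<in> hyperbolic_space. f x = T ` x}"

definition projectively_invariant ::
  "('g, 'm) monoid_scheme \<Rightarrow> ('g \<Rightarrow> (real \<times> 'h::real_inner) set \<Rightarrow> (real \<times> 'h) set) \<Rightarrow>
   (real \<times> 'h) set \<Rightarrow> bool" where
  "projectively_invariant G \<phi> V \<longleftrightarrow> (\<forall>g \<in> carrier G. \<forall>T \<in> lorentz_lifts (\<phi> g). T ` V \<subseteq> V)"

text \<open>
  The first case is Hilbertian dimension at least \<open>2\<close>. In the degenerate dimensions \<open>0\<close> and \<open>1\<close>,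
  invariant isotropic lines are allowed: a translation of a line is irreducible.
\<close>

definition irreducible_action ::
  "('g, 'm) monoid_scheme \<Rightarrow> ('g \<Rightarrow> (real \<times> 'h::real_inner) set \<Rightarrow> (real \<times> 'h) set) \<Rightarrow> bool" where
  "irreducible_action G \<phi> \<longleftrightarrow>
     (if \<exists>e f :: 'h. norm e = 1 \<and> norm f = 1 \<and> inner e f = 0
      then \<not> (\<exists>V. subspace V \<and> closed V \<and> V \<noteq> {0} \<and> V \<noteq> UNIV \<and> projectively_invariant G \<phi> V)
      else \<not> (\<exists>S. hyperbolic_subspace S \<and> S \<noteq> hyperbolic_space \<and>
                  (\<forall>g \<in> carrier G. \<phi> g ` S \<subseteq> S)))"

section \<open>Well-definedness\<close>

lemma lorentz_form_simps:
  "lorentz_form (x + y) z = lorentz_form x z + lorentz_form y z"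
  "lorentz_form z (x + y) = lorentz_form z x + lorentz_form z y"
  "lorentz_form (x - y) z = lorentz_form x z - lorentz_form y z"
  "lorentz_form z (x - y) = lorentz_form z x - lorentz_form z y"
  "lorentz_form (a *\<^sub>R x) z = a * lorentz_form x z"
  "lorentz_form z (a *\<^sub>R x) = a * lorentz_form z x"
  "lorentz_form 0 z = 0" "lorentz_form z 0 = 0"
  "lorentz_form (- x) z = - lorentz_form x z" "lorentz_form z (- x) = - lorentz_form z x"
  by (simp_all add: lorentz_form_def inner_add_left inner_add_right inner_diff_left
      inner_diff_right algebra_simps)

lemma lorentz_form_commute: "lorentz_form x y = lorentz_form y x"
  by (simp add: lorentz_form_def inner_commute mult.commute)

lemma lorentz_positive_norm:
  assumes "lorentz_form v v > 0"
  shows "norm (snd v) < \<bar>fst v\<bar>"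
proof -
  have "(norm (snd v))\<^sup>2 < \<bar>fst v\<bar>\<^sup>2"
    using assms by (simp add: lorentz_form_def dot_square_norm flip: power2_eq_square)
  then show ?thesis by (rule power2_less_imp_less) simp
qed

lemma lorentz_reverse_Cauchy_Schwarz:
  assumes "lorentz_form v v > 0" "lorentz_form w w > 0"
  shows "lorentz_form v v * lorentz_form w w \<le> (lorentz_form v w)\<^sup>2"
proof -
  let ?a = "\<bar>fst v\<bar>" and ?b = "\<bar>fst w\<bar>" and ?s = "norm (snd v)" and ?t = "norm (snd w)"
  have s: "?s < ?a" and t: "?t < ?b"
    using lorentz_positive_norm assms by blast+
  have "\<bar>inner (snd v) (snd w)\<bar> \<le> ?s * ?t" by (rule Cauchy_Schwarz_ineq2)
  then have "?a * ?b - ?s * ?t \<le> \<bar>lorentz_form v w\<bar>"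
    unfolding lorentz_form_def abs_mult[symmetric] by linarith
  moreover have "0 \<le> ?a * ?b - ?s * ?t"
    using s t mult_mono[of ?s ?a ?t ?b] by simp
  ultimately have "(?a * ?b - ?s * ?t)\<^sup>2 \<le> \<bar>lorentz_form v w\<bar>\<^sup>2"
    by (rule power_mono)
  moreover have "lorentz_form v v = ?a\<^sup>2 - ?s\<^sup>2" "lorentz_form w w = ?b\<^sup>2 - ?t\<^sup>2"
    by (simp_all add: lorentz_form_def dot_square_norm flip: power2_eq_square)
  moreover have "(?a * ?b - ?s * ?t)\<^sup>2 - (?a\<^sup>2 - ?s\<^sup>2) * (?b\<^sup>2 - ?t\<^sup>2) = (?a * ?t - ?b * ?s)\<^sup>2"
    by (simp add: power2_eq_square algebra_simps)
  moreover have "0 \<le> (?a * ?t - ?b * ?s)\<^sup>2" by simp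
  ultimately have "(\<bar>fst v\<bar>\<^sup>2 - ?s\<^sup>2) * (\<bar>fst w\<bar>\<^sup>2 - ?t\<^sup>2) \<le> \<bar>lorentz_form v w\<bar>\<^sup>2"
    and "lorentz_form v v = ?a\<^sup>2 - ?s\<^sup>2" "lorentz_form w w = ?b\<^sup>2 - ?t\<^sup>2"
    by linarith+
  then show ?thesis by (simp only: power2_abs)
qed

lemma hyperbolic_dist_span:
  assumes v: "lorentz_form v v > 0" and w: "lorentz_form w w > 0"
  shows "hyperbolic_dist (span {v}) (span {w}) \<ge> 0"
    and "cosh (hyperbolic_dist (span {v}) (span {w})) =
           \<bar>lorentz_form v w\<bar> / sqrt (lorentz_form v v * lorentz_form w w)"
proof -
  let ?r = "\<bar>lorentz_form v w\<bar> / sqrt (lorentz_form v v * lorentz_form w w)"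
  let ?P = "\<lambda>d. d \<ge> 0 \<and> (\<forall>X \<in> span {v} - {0}. \<forall>Y \<in> span {w} - {0}.
     cosh d = \<bar>lorentz_form X Y\<bar> / sqrt (lorentz_form X X * lorentz_form Y Y))"
  have pos: "0 < lorentz_form v v * lorentz_form w w" using v w by simp
  have "sqrt (lorentz_form v v * lorentz_form w w) \<le> \<bar>lorentz_form v w\<bar>"
    using real_sqrt_le_mono[OF lorentz_reverse_Cauchy_Schwarz[OF v w]] by simp
  then have r: "1 \<le> ?r" using pos by simp
  have nz: "v \<noteq> 0" "w \<noteq> 0" using v w by (auto simp: lorentz_form_simps)
  have inv: "\<bar>lorentz_form X Y\<bar> / sqrt (lorentz_form X X * lorentz_form Y Y) = ?r"
    if X: "X \<in> span {v} - {0}" and Y: "Y \<in> span {w} - {0}" for X Y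
  proof -
    obtain a b where ab: "X = a *\<^sub>R v" "Y = b *\<^sub>R w"
      using X Y by (auto simp: span_singleton)
    with X Y have "a \<noteq> 0" "b \<noteq> 0" by auto
    moreover have "lorentz_form X X * lorentz_form Y Y
        = (a * b)\<^sup>2 * (lorentz_form v v * lorentz_form w w)"
      by (simp add: ab lorentz_form_simps power2_eq_square)
    then have "sqrt (lorentz_form X X * lorentz_form Y Y)
        = \<bar>a * b\<bar> * sqrt (lorentz_form v v * lorentz_form w w)"
      by (simp only: real_sqrt_mult real_sqrt_abs)
    moreover have "\<bar>lorentz_form X Y\<bar> = \<bar>a * b\<bar> * \<bar>lorentz_form v w\<bar>"
      by (simp add: ab lorentz_form_simps abs_mult)
    ultimately show ?thesis by simp
  qed
  have "?P (arcosh ?r)"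
    using r inv by (simp add: cosh_arcosh_real arcosh_nonneg_real)
  moreover have "d = arcosh ?r" if "?P d" for d
  proof -
    have "cosh d = ?r"
      using that nz by (meson DiffI singletonD singletonI span_base)
    then show ?thesis using that by (metis arcosh_cosh_real)
  qed
  ultimately have "?P (hyperbolic_dist (span {v}) (span {w}))"
    unfolding hyperbolic_dist_def by (rule theI[where P = ?P])
  then show "hyperbolic_dist (span {v}) (span {w}) \<ge> 0"
    and "cosh (hyperbolic_dist (span {v}) (span {w})) = ?r"
    using nz by (blast, meson DiffI singletonD singletonI span_base)
qed

definition lorentz_hyperboloid :: "(real \<times> 'h::real_inner) set" where
  "lorentz_hyperboloid = {v. lorentz_form v v = 1 \<and> fst v > 0}"

lemma hyperbolic_space_hyperboloid: "hyperbolic_space = (\<lambda>v. span {v}) ` lorentz_hyperboloid"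
proof (intro equalityI subsetI)
  fix x :: "(real \<times> 'h::real_inner) set"
  assume "x \<in> hyperbolic_space"
  then obtain v where v: "x = span {v}" "lorentz_form v v > 0"
    by (auto simp: hyperbolic_space_def)
  let ?c = "sgn (fst v) / sqrt (lorentz_form v v)"
  have f: "fst v \<noteq> 0" using lorentz_positive_norm[OF v(2)] by auto
  then have c: "?c \<noteq> 0" using v by (auto simp: sgn_if)
  have "?c *\<^sub>R v \<in> lorentz_hyperboloid"
    using v(2) f by (auto simp: lorentz_hyperboloid_def lorentz_form_simps sgn_if divide_simps)
  moreover have "span {?c *\<^sub>R v} = span {v}"
  proof -
    have "v = (1 / ?c) *\<^sub>R (?c *\<^sub>R v)"
      using c by (simp only: scaleR_scaleR) (simp only: nonzero_eq_divide_eq[symmetric] divide_self_if times_divide_eq_left mult_1_left if_False scaleR_one)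
    then have "v \<in> span {?c *\<^sub>R v}" by (metis singletonI span_base span_scale)
    then show ?thesis by (intro span_eq[THEN iffD2]) (simp add: span_base span_scale)
  qed
  ultimately show "x \<in> (\<lambda>v. span {v}) ` lorentz_hyperboloid" using v(1) by blast
next
  fix x :: "(real \<times> 'h::real_inner) set"
  assume "x \<in> (\<lambda>v. span {v}) ` lorentz_hyperboloid"
  then obtain v where "x = span {v}" "lorentz_form v v = 1"
    unfolding lorentz_hyperboloid_def by blast
  then show "x \<in> hyperbolic_space"
    unfolding hyperbolic_space_def using zero_less_one by (metis (mono_tags, lifting) mem_Collect_eq)
qed

lemma lorentz_hyperboloid_ge_1:
  assumes "v \<in> lorentz_hyperboloid" "w \<in> lorentz_hyperboloid"
  shows "lorentz_form v w \<ge> 1"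
proof -
  have *: "lorentz_form v v = 1" "lorentz_form w w = 1" "fst v > 0" "fst w > 0"
    using assms by (auto simp: lorentz_hyperboloid_def)
  have "norm (snd v) < fst v" "norm (snd w) < fst w"
    using lorentz_positive_norm[of v] lorentz_positive_norm[of w] * by auto
  then have "norm (snd v) * norm (snd w) \<le> fst v * fst w"
    using * by (intro mult_mono) auto
  then have "0 \<le> lorentz_form v w"
    using Cauchy_Schwarz_ineq2[of "snd v" "snd w"] unfolding lorentz_form_def by linarith
  moreover have "1 \<le> (lorentz_form v w)\<^sup>2"
    using lorentz_reverse_Cauchy_Schwarz[of v w] * by simp
  ultimately show ?thesis by (metis abs_of_nonneg one_le_power power2_le_imp_le power_one)
qed

lemma cosh_dist_hyperboloid:
  assumes "v \<in> lorentz_hyperboloid" "w \<in> lorentz_hyperboloid"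
  shows "cosh (hyperbolic_dist (span {v}) (span {w})) = lorentz_form v w"
  using assms lorentz_hyperboloid_ge_1[OF assms]
  by (simp add: hyperbolic_dist_span(2) lorentz_hyperboloid_def)

lemma lorentz_hyperboloid_spans:
  "\<exists>a b v w. v \<in> lorentz_hyperboloid \<and> w \<in> lorentz_hyperboloid \<and>
     (x :: real \<times> 'h::real_inner) = a *\<^sub>R v + b *\<^sub>R w"
proof -
  define e :: "real \<times> 'h" where "e = (1, 0)"
  define c where "c = 1 + \<bar>fst x\<bar> + norm (snd x)"
  define y where "y = x + c *\<^sub>R e"
  have "fst y = fst x + c" "snd y = snd x" by (simp_all add: y_def e_def)
  then have y: "norm (snd y) < fst y" by (simp add: c_def)
  then have "(norm (snd y))\<^sup>2 < (fst y)\<^sup>2" by (intro power_strict_mono) auto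
  then have p: "lorentz_form y y > 0"
    by (simp add: lorentz_form_def dot_square_norm flip: power2_eq_square)
  define r where "r = sqrt (lorentz_form y y)"
  have r: "r > 0" "r * r = lorentz_form y y" using p by (auto simp: r_def)
  have fy: "fst y > 0" using y norm_ge_zero[of "snd y"] by linarith
  have "(1 / r) *\<^sub>R y \<in> lorentz_hyperboloid"
    using r p fy by (simp add: lorentz_hyperboloid_def lorentz_form_simps flip: r(2))
  moreover have "e \<in> lorentz_hyperboloid"
    by (simp add: e_def lorentz_hyperboloid_def lorentz_form_def)
  moreover have "x = r *\<^sub>R ((1 / r) *\<^sub>R y) + (- c) *\<^sub>R e" using r by (simp add: y_def)
  ultimately show ?thesis by blast
qed

lemma lorentz_form_hyperboloid_cancel:
  fixes x y :: "real \<times> 'h::real_inner"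
  assumes "\<And>s. s \<in> lorentz_hyperboloid \<Longrightarrow> lorentz_form x s = lorentz_form y s"
  shows "x = y"
proof -
  have "lorentz_form (x - y) z = 0" for z
  proof -
    obtain a b v w where "v \<in> lorentz_hyperboloid" "w \<in> lorentz_hyperboloid" "z = a *\<^sub>R v + b *\<^sub>R w"
      using lorentz_hyperboloid_spans by blast
    then show ?thesis using assms by (simp add: lorentz_form_simps)
  qed
  from this[of "(fst (x - y), - snd (x - y))"]
  have "(fst (x - y))\<^sup>2 + (norm (snd (x - y)))\<^sup>2 = 0"
    by (simp add: lorentz_form_def power2_norm_eq_inner power2_eq_square[of "fst x - fst y"])
     (simp add: inner_diff_left inner_diff_right algebra_simps)
  then show ?thesis by (simp add: sum_power2_eq_zero_iff prod_eq_iff)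
qed

lemma lorentz_lifts_nonempty:
  fixes f :: "(real \<times> 'h::real_inner) set \<Rightarrow> (real \<times> 'h) set"
  assumes bij: "bij_betw f hyperbolic_space hyperbolic_space"
    and iso: "\<And>x y. x \<in> hyperbolic_space \<Longrightarrow> y \<in> hyperbolic_space \<Longrightarrow>
                hyperbolic_dist (f x) (f y) = hyperbolic_dist x y"
  obtains T where "T \<in> lorentz_lifts f"
proof -
  let ?S = "lorentz_hyperboloid :: (real \<times> 'h) set"
  have "\<forall>v\<in>?S. \<exists>w\<in>?S. f (span {v}) = span {w}"
  proof
    fix v assume "v \<in> ?S"
    then have "f (span {v}) \<in> hyperbolic_space"
      using bij by (auto simp: bij_betw_def hyperbolic_space_hyperboloid)
    then show "\<exists>w\<in>?S. f (span {v}) = span {w}" by (auto simp: hyperbolic_space_hyperboloid)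
  qed
  then obtain F where F: "\<And>v. v \<in> ?S \<Longrightarrow> F v \<in> ?S" "\<And>v. v \<in> ?S \<Longrightarrow> f (span {v}) = span {F v}"
    by metis
  have pres: "lorentz_form (F v) (F w) = lorentz_form v w" if "v \<in> ?S" "w \<in> ?S" for v w
  proof -
    have "hyperbolic_dist (f (span {v})) (f (span {w})) = hyperbolic_dist (span {v}) (span {w})"
      by (rule iso) (use that in \<open>auto simp: hyperbolic_space_hyperboloid\<close>)
    then show ?thesis
      using that F by (metis cosh_dist_hyperboloid)
  qed
  have inj_line: "v = w" if "v \<in> ?S" "w \<in> ?S" "span {v} = span {w}" for v w
  proof -
    have "v \<in> span {w}" using that(3) by (metis singletonI span_base)
    then obtain k where k: "v = k *\<^sub>R w" by (auto simp: span_singleton)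
    with that have "k * k = 1" "0 < k * fst w" "0 < fst w"
      by (auto simp: lorentz_hyperboloid_def lorentz_form_simps)
    then have "k = 1" by (auto simp: square_eq_1_iff)
    with k show ?thesis by simp
  qed
  have surjF: "\<exists>v\<in>?S. F v = w" if w: "w \<in> ?S" for w
  proof -
    have "span {w} \<in> f ` hyperbolic_space"
      using bij w by (auto simp: bij_betw_def hyperbolic_space_hyperboloid)
    then obtain v where "v \<in> ?S" "span {w} = f (span {v})"
      by (auto simp: hyperbolic_space_hyperboloid)
    then show ?thesis using F inj_line w by metis
  qed
  have "\<forall>x. \<exists>y. \<forall>s\<in>?S. lorentz_form y (F s) = lorentz_form x s"
  proof
    fix x
    obtain a b v w where "v \<in> ?S" "w \<in> ?S" "x = a *\<^sub>R v + b *\<^sub>R w"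
      using lorentz_hyperboloid_spans by blast
    then show "\<exists>y. \<forall>s\<in>?S. lorentz_form y (F s) = lorentz_form x s"
      by (intro exI[of _ "a *\<^sub>R F v + b *\<^sub>R F w"]) (simp add: lorentz_form_simps pres)
  qed
  then obtain T where T: "\<And>x s. s \<in> ?S \<Longrightarrow> lorentz_form (T x) (F s) = lorentz_form x s"
    by metis
  have unique: "y = T x" if "\<And>s. s \<in> ?S \<Longrightarrow> lorentz_form y (F s) = lorentz_form x s" for x y
    by (rule lorentz_form_hyperboloid_cancel) (metis surjF T that)
  have TF: "T v = F v" if "v \<in> ?S" for v
    using unique[of "F v" v] pres that by simp
  have add: "T (x + y) = T x + T y" for x y
    by (rule unique[symmetric]) (simp add: lorentz_form_simps T)
  have scale: "T (a *\<^sub>R x) = a *\<^sub>R T x" for a x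
    by (rule unique[symmetric]) (simp add: lorentz_form_simps T)
  have lin: "linear T" by (rule linearI) (fact add scale)+
  have form: "lorentz_form (T x) (T y) = lorentz_form x y" for x y
  proof -
    obtain a b v w where "v \<in> ?S" "w \<in> ?S" "y = a *\<^sub>R v + b *\<^sub>R w"
      using lorentz_hyperboloid_spans by blast
    then show ?thesis by (simp add: add scale TF T lorentz_form_simps)
  qed
  have "inj T"
  proof (rule injI)
    fix x y assume "T x = T y"
    then show "x = y" by (intro lorentz_form_hyperboloid_cancel) (metis form)
  qed
  moreover have "surj T"
    unfolding surj_def
  proof
    fix y
    obtain a b v w where y: "v \<in> ?S" "w \<in> ?S" "y = a *\<^sub>R v + b *\<^sub>R w"
      using lorentz_hyperboloid_spans by blast
    then obtain v' w' where "v' \<in> ?S" "w' \<in> ?S" "F v' = v" "F w' = w" using surjF by metis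
    then have "T (a *\<^sub>R v' + b *\<^sub>R w') = y" by (simp add: add scale TF y)
    then show "\<exists>x. y = T x" by blast
  qed
  ultimately have "T \<in> lorentz_group"
    using lin form by (simp add: lorentz_group_def bij_def)
  moreover have "f x = T ` x" if x: "x \<in> hyperbolic_space" for x
  proof -
    obtain v where v: "v \<in> ?S" "x = span {v}" using x by (auto simp: hyperbolic_space_hyperboloid)
    have "T ` span {v} = span {T v}"
      using linear_span_image[OF lin, of "{v}"] by simp
    then show ?thesis using v F TF by simp
  qed
  ultimately have "T \<in> lorentz_lifts f" by (simp add: lorentz_lifts_def)
  then show ?thesis by (rule that)
qed

lemma lorentz_lifts_isometry:
  fixes f :: "(real \<times> 'h::real_inner) set \<Rightarrow> (real \<times> 'h) set"
  assumes "bij_betw f hyperbolic_space hyperbolic_space"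
    and "\<And>x y. x \<in> hyperbolic_space \<Longrightarrow> y \<in> hyperbolic_space \<Longrightarrow>
           hyperbolic_dist (f x) (f y) = hyperbolic_dist x y"
  shows "\<exists>T \<in> lorentz_group. lorentz_lifts f = {T, \<lambda>x. - T x}"
proof -
  let ?S = "lorentz_hyperboloid :: (real \<times> 'h) set"
  have line: "span {v} \<in> hyperbolic_space" if "v \<in> ?S" for v
    using that by (auto simp: hyperbolic_space_hyperboloid)
  obtain T where T: "T \<in> lorentz_lifts f" by (rule lorentz_lifts_nonempty[OF assms])
  then have TG: "linear T" "bij T" "\<And>x y. lorentz_form (T x) (T y) = lorentz_form x y"
    and Tf: "\<And>x. x \<in> hyperbolic_space \<Longrightarrow> f x = T ` x"
    by (auto simp: lorentz_lifts_def lorentz_group_def)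
  have neg: "(\<lambda>x. - T x) \<in> lorentz_lifts f"
  proof -
    have "bij (\<lambda>x. - T x)"
      using bij_comp[OF TG(2) bij_uminus] by (simp add: o_def)
    moreover have "linear (\<lambda>x. - T x)" using TG(1) by (rule linear_compose_neg)
    moreover have "T ` x = (\<lambda>x. - T x) ` x" if x: "x \<in> hyperbolic_space" for x
    proof -
      obtain v where v: "x = span {v}" using x unfolding hyperbolic_space_def by blast
      have "T ` span {v} = span {T v}" "(\<lambda>x. - T x) ` span {v} = span {- T v}"
        using linear_span_image[OF TG(1), of "{v}"]
          linear_span_image[OF \<open>linear (\<lambda>x. - T x)\<close>, of "{v}"] by simp_all
      moreover have "span {- T v} = span {T v}"
        by (intro span_eq[THEN iffD2]) (auto simp: span_base span_neg intro: span_neg[of "- T v", simplified])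
      ultimately show ?thesis using v by simp
    qed
    ultimately show ?thesis
      using Tf by (simp add: lorentz_lifts_def lorentz_group_def lorentz_form_simps TG(3))
  qed
  have only: "U = T \<or> U = (\<lambda>x. - T x)" if "U \<in> lorentz_lifts f" for U
  proof -
    have UG: "linear U" "\<And>x y. lorentz_form (U x) (U y) = lorentz_form x y"
      and Uf: "\<And>x. x \<in> hyperbolic_space \<Longrightarrow> f x = U ` x"
      using that by (auto simp: lorentz_lifts_def lorentz_group_def)
    have "\<exists>k. U v = k *\<^sub>R T v \<and> k * k = 1" if v: "v \<in> ?S" for v
    proof -
      have "U ` span {v} = T ` span {v}" using Uf Tf line[OF v] by metis
      then have "span {U v} = span {T v}"
        using linear_span_image[OF TG(1), of "{v}"] linear_span_image[OF UG(1), of "{v}"] by simp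
      then have "U v \<in> span {T v}" by (metis singletonI span_base)
      then obtain k where k: "U v = k *\<^sub>R T v" by (auto simp: span_singleton)
      have "lorentz_form (U v) (U v) = lorentz_form (T v) (T v)" by (simp add: UG TG)
      then have "k * k = 1"
        using v by (simp add: k lorentz_form_simps TG(3) lorentz_hyperboloid_def)
      with k show ?thesis by blast
    qed
    then obtain k where k: "\<And>v. v \<in> ?S \<Longrightarrow> U v = k v *\<^sub>R T v" "\<And>v. v \<in> ?S \<Longrightarrow> k v * k v = 1"
      by metis
    have const: "k v = k w" if "v \<in> ?S" "w \<in> ?S" for v w
    proof -
      have "lorentz_form (U v) (U w) = k v * k w * lorentz_form (T v) (T w)"
        using k that by (simp add: lorentz_form_simps)
      then have "k v * k w = 1"
        using lorentz_hyperboloid_ge_1[OF that] by (simp add: UG TG)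
      then show ?thesis using k(2)[OF that(1)] k(2)[OF that(2)]
        by (metis mult.commute mult.left_commute mult_1)
    qed
    obtain v0 where v0: "v0 \<in> ?S" using lorentz_hyperboloid_spans[where 'h = 'h] by blast
    have "U x = k v0 *\<^sub>R T x" for x
    proof -
      obtain a b v w where "v \<in> ?S" "w \<in> ?S" "x = a *\<^sub>R v + b *\<^sub>R w"
        using lorentz_hyperboloid_spans by blast
      then show ?thesis
        using const[OF _ v0] k(1)
        by (simp add: linear_add[OF UG(1)] linear_add[OF TG(1)] linear_scale[OF UG(1)]
            linear_scale[OF TG(1)] scaleR_add_right mult.commute)
    qed
    moreover have "k v0 = 1 \<or> k v0 = - 1" using k(2)[OF v0] by (simp add: square_eq_1_iff)
    ultimately show ?thesis by (auto simp: fun_eq_iff)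
  qed
  have "lorentz_lifts f = {T, \<lambda>x. - T x}" using T neg only by auto
  moreover have "T \<in> lorentz_group" using T by (simp add: lorentz_lifts_def)
  ultimately show ?thesis by blast
qed

end

theory Submission
  imports Defs
begin

text \<open>
  Lift the action to Lorentz transformations \<open>T g\<close> preserving the upper sheet of the hyperboloid, so
  that \<open>F g\<close> is the Lorentz product of \<open>T g v\<close> and \<open>v\<close>. Given a proper invariant closed subspace, one
  exhibits a function \<open>F'\<close> of hyperbolic type with \<open>F' \<le> F\<close> and \<open>F / F'\<close> bounded. If the subspace or its
  Lorentz complement contains a positive vector, \<open>F'\<close> comes from the projection of \<open>v\<close> to it.
  Otherwise there is an invariant isotropic line, that is, a fixed point at infinity; in horospherical
  coordinates centred there, \<open>F'\<close> comes from contracting the horizontal coordinate, a map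
  commuting with the similarities by which the group acts. Then \<open>F' = F\<close> contradicts the
  totality of the orbit.
\<close>

section \<open>Orthogonal projection in a Hilbert space\<close>

text \<open>The parallelogram law for \<open>x - y\<close> and \<open>x - z\<close>, arranged so
  that two nearly optimal approximations of \<open>x\<close> with a well-placed midpoint must be
  close to each other.\<close>

lemma parallelogram_midpoint:
  fixes x y z :: "'a::real_inner"
  shows "(norm (y - z))\<^sup>2 = 2 * (norm (x - y))\<^sup>2 + 2 * (norm (x - z))\<^sup>2
    - 4 * (norm (x - (1/2) *\<^sub>R (y + z)))\<^sup>2"
  by (simp add: power2_norm_eq_inner inner_commute algebra_simps)

text \<open>A minimising sequence is Cauchy because midpoints stay in \<open>W\<close> and so cannot
  beat the infimum \<open>d\<close>; closedness keeps the limit in \<open>W\<close>.\<close>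

lemma closed_subspace_nearest_point:
  fixes x :: "'a::{real_inner, complete_space}"
  assumes W: "subspace W" "closed W"
  obtains y where "y \<in> W" "\<And>w. w \<in> W \<Longrightarrow> norm (x - y) \<le> norm (x - w)"
proof -
  define d where "d = (INF w\<in>W. (norm (x - w))\<^sup>2)"
  have bdd: "bdd_below ((\<lambda>w. (norm (x - w))\<^sup>2) ` W)" by (rule bdd_belowI2[of _ 0]) simp
  have ne: "W \<noteq> {}" using subspace_0[OF W(1)] by blast
  have d: "d \<le> (norm (x - w))\<^sup>2" if "w \<in> W" for w
    unfolding d_def by (rule cINF_lower[OF bdd that])
  have "\<exists>w\<in>W. (norm (x - w))\<^sup>2 < d + 1 / Suc n" for n :: nat
  proof -
    have "d < d + 1 / Suc n" by simp
    then show ?thesis unfolding d_def using cINF_less_iff[OF ne bdd] by blast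
  qed
  then obtain f where f: "\<And>n. f n \<in> W" "\<And>n::nat. (norm (x - f n))\<^sup>2 < d + 1 / Suc n"
    by metis
  have close: "(norm (f m - f n))\<^sup>2 < 4 / Suc N" if "m \<ge> N" "n \<ge> N" for m n N
  proof -
    have "(1/2) *\<^sub>R (f m + f n) \<in> W" using W f by (simp add: subspace_add subspace_scale)
    moreover have "1 / real (Suc m) \<le> 1 / Suc N" "1 / real (Suc n) \<le> 1 / Suc N"
      using that by (simp_all add: frac_le)
    ultimately show ?thesis
      using d[of "(1/2) *\<^sub>R (f m + f n)"] f(2)[of m] f(2)[of n]
      unfolding parallelogram_midpoint[of "f m" "f n" x] by argo
  qed
  have "Cauchy f"
  proof (rule metric_CauchyI)
    fix e :: real assume e: "0 < e"
    obtain N where N: "1 / real (Suc N) < e\<^sup>2 / 4"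
      using nat_approx_posE[of "e\<^sup>2 / 4"] e by auto
    have "dist (f m) (f n) < e" if "m \<ge> N" "n \<ge> N" for m n
    proof -
      have "(norm (f m - f n))\<^sup>2 < e\<^sup>2" using close[OF that] N by argo
      then show ?thesis using e by (simp add: dist_norm power_less_imp_less_base)
    qed
    then show "\<exists>M. \<forall>m\<ge>M. \<forall>n\<ge>M. dist (f m) (f n) < e" by blast
  qed
  then obtain y where y: "f \<longlonglongrightarrow> y" by (auto simp: Cauchy_convergent_iff convergent_def)
  have "y \<in> W" using closed_sequentially[OF W(2) f(1) y] .
  moreover have "(norm (x - y))\<^sup>2 \<le> d"
  proof (rule LIMSEQ_le)
    show "(\<lambda>n. (norm (x - f n))\<^sup>2) \<longlonglongrightarrow> (norm (x - y))\<^sup>2" by (intro tendsto_intros y)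
    show "(\<lambda>n. d + 1 / Suc n) \<longlonglongrightarrow> d"
      using tendsto_add[OF tendsto_const LIMSEQ_inverse_real_of_nat] by (simp add: inverse_eq_divide)
    show "\<exists>N. \<forall>n\<ge>N. (norm (x - f n))\<^sup>2 \<le> d + 1 / Suc n" using f(2) less_imp_le by blast
  qed
  ultimately show ?thesis using d order_trans that power2_le_imp_le norm_ge_zero by metis
qed

lemma closed_subspace_orthogonal_projection:
  fixes x :: "'a::{real_inner, complete_space}"
  assumes W: "subspace W" "closed W"
  obtains y where "y \<in> W" "\<And>w. w \<in> W \<Longrightarrow> inner (x - y) w = 0"
proof -
  obtain y where y: "y \<in> W" "\<And>w. w \<in> W \<Longrightarrow> norm (x - y) \<le> norm (x - w)"
    using closed_subspace_nearest_point[OF W] by blast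
  have "inner (x - y) w = 0" if w: "w \<in> W" for w
  proof (cases "w = 0")
    case False
    \<comment> \<open>With this \<open>t\<close>, \<open>t *\<^sub>R w\<close> is the point of the
      line of \<open>w\<close> closest to \<open>x - y\<close>; optimality of \<open>y\<close>
      leaves no room for improvement.\<close>
    define t where "t = inner (x - y) w / inner w w"
    have "y + t *\<^sub>R w \<in> W" using W y w by (simp add: subspace_add subspace_scale)
    then have "(norm (x - y))\<^sup>2 \<le> (norm ((x - y) - t *\<^sub>R w))\<^sup>2"
      using y(2) by (simp add: diff_diff_eq power_mono)
    also have "\<dots> = (norm (x - y))\<^sup>2 - 2 * t * inner (x - y) w + t * t * inner w w"
      by (simp add: power2_norm_eq_inner inner_commute algebra_simps)
    also have "t * t * inner w w = t * inner (x - y) w" using False by (simp add: t_def)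
    finally have "t * inner (x - y) w \<le> 0" by argo
    then have "(inner (x - y) w)\<^sup>2 \<le> 0"
      using False inner_gt_zero_iff[of w]
      by (simp add: t_def divide_le_0_iff power2_eq_square not_le del: inner_gt_zero_iff)
    then show ?thesis by simp
  qed simp
  with y(1) show ?thesis by (rule that)
qed

section \<open>The Lorentz form\<close>

lemma continuous_on_lorentz_form [continuous_intros]:
  "continuous_on S f \<Longrightarrow> continuous_on S g \<Longrightarrow> continuous_on S (\<lambda>x. lorentz_form (f x) (g x))"
  unfolding lorentz_form_def by (intro continuous_intros)

lemma lorentz_form_sum:
  "lorentz_form (sum f A) z = (\<Sum>i\<in>A. lorentz_form (f i) z)"
  "lorentz_form z (sum f A) = (\<Sum>i\<in>A. lorentz_form z (f i))"
  by (induction A rule: infinite_finite_induct) (simp_all add: lorentz_form_simps)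

text \<open>Subtracting the multiple of \<open>l\<close> that kills the first coordinate does not
  change \<open>lorentz_form x x\<close>, and the form of a horizontal vector is minus its squared
  norm.\<close>

lemma lorentz_form_orthogonal_isotropic:
  assumes l: "lorentz_form l l = 0" "l \<noteq> 0" and x: "lorentz_form x l = 0"
  shows "lorentz_form x x \<le> 0"
    and "lorentz_form x x = 0 \<Longrightarrow> x = (fst x / fst l) *\<^sub>R l"
proof -
  have "fst l \<noteq> 0"
    using l by (auto simp: lorentz_form_def prod_eq_iff)
  define n where "n = x - (fst x / fst l) *\<^sub>R l"
  have "fst n = 0" using \<open>fst l \<noteq> 0\<close> by (simp add: n_def)
  then have "lorentz_form n n = - (norm (snd n))\<^sup>2"
    by (simp add: lorentz_form_def power2_norm_eq_inner)
  moreover have "lorentz_form n n = lorentz_form x x"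
    using l x by (simp add: n_def lorentz_form_simps lorentz_form_commute[of l x])
  ultimately have n: "lorentz_form x x = - (norm (snd n))\<^sup>2" by simp
  then show "lorentz_form x x \<le> 0" by simp
  show "x = (fst x / fst l) *\<^sub>R l" if "lorentz_form x x = 0"
  proof -
    have "n = 0" using n that \<open>fst n = 0\<close> by (simp add: prod_eq_iff)
    then show ?thesis by (simp add: n_def)
  qed
qed

text \<open>The sign comes from the reverse Cauchy-Schwarz inequality. A nonzero isotropic
  \<open>x\<close> is excluded since the positive \<open>w\<close> would lie in its
  complement.\<close>

lemma lorentz_form_orthogonal_positive:
  assumes w: "lorentz_form w w > 0" and x: "lorentz_form x w = 0"
  shows "lorentz_form x x \<le> 0" and "lorentz_form x x = 0 \<Longrightarrow> x = 0"
proof -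
  show "lorentz_form x x \<le> 0"
  proof (rule ccontr)
    assume "\<not> lorentz_form x x \<le> 0"
    then have "lorentz_form x x * lorentz_form w w \<le> 0" "0 < lorentz_form x x * lorentz_form w w"
      using lorentz_reverse_Cauchy_Schwarz[of x w] w x by simp_all
    then show False by linarith
  qed
  show "x = 0" if "lorentz_form x x = 0"
    using lorentz_form_orthogonal_isotropic(1)[of x w] that w x
    by (auto simp: lorentz_form_commute)
qed

text \<open>The form is a quadratic polynomial in \<open>c\<close> with positive leading
  coefficient. It follows that a subspace with a positive vector is spanned by its positive
  vectors.\<close>

lemma positive_vectors_span:
  fixes w u :: "real \<times> 'h::real_inner"
  assumes "lorentz_form w w > 0"
  obtains c where "lorentz_form (u + c *\<^sub>R w) (u + c *\<^sub>R w) > 0"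
proof -
  let ?p = "lorentz_form w w" and ?q = "lorentz_form u w" and ?r = "lorentz_form u u"
  define c where "c = (1 + \<bar>?r\<bar> + 2 * \<bar>?q\<bar>) / ?p + 1"
  have c: "c \<ge> 1" "c * ?p \<ge> 1 + \<bar>?r\<bar> + 2 * \<bar>?q\<bar>"
    using assms by (auto simp only: c_def distrib_right) (auto simp: c_def)
  have "c * (c * ?p) \<ge> c * (1 + \<bar>?r\<bar> + 2 * \<bar>?q\<bar>)" using c by (intro mult_left_mono) auto
  moreover have "c * (1 + \<bar>?r\<bar>) \<ge> 1 + \<bar>?r\<bar>" "2 * (c * \<bar>?q\<bar>) \<ge> - (2 * (c * ?q))"
    using c mult_right_mono[of 1 c "1 + \<bar>?r\<bar>"] mult_left_mono[of "- ?q" "\<bar>?q\<bar>" c] by auto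
  ultimately have "c * (c * ?p) + 2 * (c * ?q) + ?r > 0" by (simp add: algebra_simps)
  then have "lorentz_form (u + c *\<^sub>R w) (u + c *\<^sub>R w) > 0"
    by (simp add: lorentz_form_simps lorentz_form_commute[of w u] algebra_simps)
  then show ?thesis by (rule that)
qed

section \<open>Lorentz complements, projections and the signature of a closed subspace\<close>

definition lorentz_complement :: "(real \<times> 'h::real_inner) set \<Rightarrow> (real \<times> 'h) set" where
  "lorentz_complement W = {x. \<forall>w\<in>W. lorentz_form x w = 0}"

lemma subspace_lorentz_complement: "subspace (lorentz_complement W)"
  by (auto simp: lorentz_complement_def subspace_def lorentz_form_simps)

lemma closed_lorentz_complement: "closed (lorentz_complement W)"
proof -
  have "lorentz_complement W = (\<Inter>w\<in>W. {x. lorentz_form x w = 0})"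
    by (auto simp: lorentz_complement_def)
  moreover have "closed {x. lorentz_form x w = 0}" for w :: "real \<times> 'a"
    by (intro closed_Collect_eq continuous_intros)
  ultimately show ?thesis by auto
qed

text \<open>
  Since \<open>lorentz_form\<close> differs from the inner product by the reflection \<open>(r, u) \<mapsto> (r, - u)\<close>, the
  Euclidean projection \<open>q\<close> of \<open>(1, 0)\<close> to \<open>W\<close> decides the signature of \<open>W\<close>: one has
  \<open>lorentz_form q q = fst q * (2 * fst q - 1)\<close>, and \<open>W\<close> is the Lorentz orthogonal sum of the line of \<open>q\<close>
  and of a subspace of \<open>H\<close>.
\<close>

lemma projection_of_axis:
  fixes W :: "(real \<times> 'h::{real_inner, complete_space}) set"
  assumes W: "subspace W" "closed W"
  obtains q where "q \<in> W" "\<And>w. w \<in> W \<Longrightarrow> inner q w = fst w"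
    "lorentz_form q q = fst q * (2 * fst q - 1)"
proof -
  obtain q where q: "q \<in> W" "\<And>w. w \<in> W \<Longrightarrow> inner ((1, 0) - q) w = 0"
    using closed_subspace_orthogonal_projection[OF W, of "(1, 0)"] by blast
  have iq: "inner q w = fst w" if "w \<in> W" for w
    using q(2)[OF that] by (simp add: inner_diff_left) (simp add: inner_prod_def)
  have e: "inner (snd q) (snd q) = fst q - fst q * fst q"
    using iq[OF q(1)] by (simp add: inner_prod_def)
  with q(1) iq e show ?thesis by (intro that[of q]) (auto simp: lorentz_form_def algebra_simps)
qed

lemma lorentz_form_of_horizontal:
  "fst w = 0 \<Longrightarrow> lorentz_form x w = - inner x w"
  by (simp add: lorentz_form_def inner_prod_def)

text \<open>On the horizontal part \<open>K\<close> of \<open>W\<close> the form is minus the inner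
  product, so the Euclidean projection serves there. The vector \<open>q\<close> is Lorentz
  orthogonal to \<open>K\<close>, and the positive vector \<open>w\<close> forces \<open>q\<close>
  to be positive, so that one can also project to its line.\<close>

lemma lorentz_projection:
  fixes W :: "(real \<times> 'h::{real_inner, complete_space}) set"
  assumes W: "subspace W" "closed W" and w: "w \<in> W" "lorentz_form w w > 0"
  obtains y where "y \<in> W" "x - y \<in> lorentz_complement W"
proof -
  obtain q where q: "q \<in> W" "\<And>w. w \<in> W \<Longrightarrow> inner q w = fst w"
    using projection_of_axis[OF W] by metis
  define K where "K = W \<inter> {k. fst k = 0}"
  have K: "subspace K" "closed K"
    using W unfolding K_def
    by (auto simp: subspace_def intro!: closed_Int closed_Collect_eq continuous_intros)
  have qK: "lorentz_form q k = 0" if "k \<in> K" for k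
    using q(2)[of k] that by (simp add: K_def lorentz_form_of_horizontal)
  have decomp: "\<exists>a. \<exists>k\<in>K. z = a *\<^sub>R q + k" if z: "z \<in> W" for z
  proof (cases "fst q = 0")
    case True
    then have "q = 0" using q by (metis inner_eq_zero_iff)
    then have "fst z = 0" using q(2)[OF z] by simp
    then show ?thesis using z by (intro exI[of _ 0] bexI[of _ z]) (auto simp: K_def)
  next
    case False
    let ?a = "fst z / fst q"
    have "z - ?a *\<^sub>R q \<in> K"
      using False z q(1) W by (simp add: K_def subspace_diff subspace_scale)
    then show ?thesis by (intro exI[of _ ?a] bexI[of _ "z - ?a *\<^sub>R q"]) auto
  qed
  obtain a k where ak: "k \<in> K" "w = a *\<^sub>R q + k" using decomp[OF w(1)] by blast
  have "lorentz_form w w = a * a * lorentz_form q q + lorentz_form k k"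
    using qK[OF ak(1)] by (simp add: ak(2) lorentz_form_simps lorentz_form_commute[of k q])
  moreover have "lorentz_form k k \<le> 0"
    using ak(1) by (simp add: K_def lorentz_form_of_horizontal)
  ultimately have qq: "lorentz_form q q > 0"
    using w(2) by (metis add.right_neutral add_mono leD linorder_not_less mult_nonneg_nonpos zero_le_square)
  obtain m where m: "m \<in> K" "\<And>k. k \<in> K \<Longrightarrow> inner (x - m) k = 0"
    using closed_subspace_orthogonal_projection[OF K, of x] by blast
  define y where "y = m + (lorentz_form x q / lorentz_form q q) *\<^sub>R q"
  have "lorentz_form (x - y) q = 0"
    using qK[OF m(1)] qq by (simp add: y_def lorentz_form_simps lorentz_form_commute[of m q])
  moreover have "lorentz_form (x - y) k = 0" if k: "k \<in> K" for k
  proof -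
    have "lorentz_form (x - m) k = 0" using m(2)[OF k] k by (simp add: K_def lorentz_form_of_horizontal)
    then show ?thesis using qK[OF k] by (simp add: y_def lorentz_form_simps)
  qed
  ultimately have "lorentz_form (x - y) z = 0" if "z \<in> W" for z
    using decomp[OF that] by (auto simp: lorentz_form_simps)
  then have "x - y \<in> lorentz_complement W" by (simp add: lorentz_complement_def)
  moreover have "y \<in> W"
    using m(1) q(1) W by (simp add: y_def K_def subspace_add subspace_scale)
  ultimately show ?thesis by (rule that[rotated])
qed

lemma closed_subspace_trichotomy:
  fixes W :: "(real \<times> 'h::{real_inner, complete_space}) set"
  assumes W: "subspace W" "closed W"
  obtains (positive) w where "w \<in> W" "lorentz_form w w > 0"
  | (isotropic) l where "l \<in> W" "l \<noteq> 0" "lorentz_form l l = 0" "\<And>w. w \<in> W \<Longrightarrow> lorentz_form w w \<le> 0"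
  | (negative) w where "w \<in> lorentz_complement W" "lorentz_form w w > 0"
proof -
  obtain q where q: "q \<in> W" "\<And>w. w \<in> W \<Longrightarrow> inner q w = fst w"
    "lorentz_form q q = fst q * (2 * fst q - 1)"
    using projection_of_axis[OF W] by metis
  consider "fst q < 1/2" | "fst q = 1/2" | "fst q > 1/2" by linarith
  then show ?thesis
  proof cases
    case 1
    \<comment> \<open>The reflection of \<open>(1, 0) - q\<close>, which turns Euclidean
      orthogonality to \<open>W\<close> into Lorentz orthogonality.\<close>
    define n where "n = (1 - fst q, snd q)"
    have "lorentz_form n w = 0" if "w \<in> W" for w
      using q(2)[OF that] by (simp add: n_def lorentz_form_def inner_prod_def algebra_simps)
    moreover have "lorentz_form n n = lorentz_form q q + (1 - 2 * fst q)"
      by (simp add: n_def lorentz_form_def algebra_simps)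
    then have "lorentz_form n n = (1 - fst q) * (1 - 2 * fst q)"
      unfolding q(3) by (simp add: algebra_simps)
    then have "lorentz_form n n > 0" using 1 by simp
    ultimately show ?thesis using negative[of n] by (simp add: lorentz_complement_def)
  next
    case 2
    then have "lorentz_form q q = 0" "q \<noteq> 0" using q(3) by auto
    \<comment> \<open>A positive vector of \<open>W\<close>, if there is one, gives the first
      alternative; otherwise \<open>q\<close> gives the second.\<close>
    then show ?thesis using isotropic[of q] positive q(1) by (meson linorder_not_less)
  next
    case 3
    then have "lorentz_form q q > 0" using q(3) by simp
    then show ?thesis using positive q(1) by blast
  qed
qed

section \<open>Kernels of real hyperbolic type from points of the hyperboloid\<close>

text \<open>Reduces the kernel inequality to the sign of the form at one vector. It is applied with
  \<open>P = 0\<close>, \<open>s = 1\<close> to orbits and with \<open>s = 1/2\<close> to the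
  contraction.\<close>

lemma quadratic_form_sum:
  fixes c P :: "nat \<Rightarrow> real"
  shows "(\<Sum>j<n. \<Sum>k<n. c j * c k * (P j * P k - s * lorentz_form (m j) (m k)))
    = (\<Sum>j<n. c j * P j)\<^sup>2
      - s * lorentz_form (\<Sum>j<n. c j *\<^sub>R m j) (\<Sum>j<n. c j *\<^sub>R m j)"
proof -
  have "(\<Sum>j<n. \<Sum>k<n. c j * c k * (P j * P k - s * lorentz_form (m j) (m k)))
    = (\<Sum>j<n. \<Sum>k<n. (c j * P j) * (c k * P k))
      - s * (\<Sum>j<n. \<Sum>k<n. c j * (c k * lorentz_form (m j) (m k)))"
    by (simp add: sum_distrib_left sum_subtractf[symmetric] algebra_simps)
  moreover have "lorentz_form (\<Sum>j<n. c j *\<^sub>R m j) (\<Sum>j<n. c j *\<^sub>R m j)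
    = (\<Sum>j<n. \<Sum>k<n. c j * (c k * lorentz_form (m j) (m k)))"
    by (simp only: lorentz_form_sum(1)) (simp add: lorentz_form_sum(2) lorentz_form_simps sum_distrib_left mult.left_commute)
  ultimately show ?thesis by (simp only: power2_eq_square sum_product)
qed

text \<open>The kernel expression at \<open>x0\<close> is minus the form on components orthogonal to
  the positive vector \<open>z x0\<close>, where the form is non-positive.\<close>

lemma real_hyperbolic_kernel_hyperboloid:
  assumes "\<And>x. x \<in> X \<Longrightarrow> z x \<in> lorentz_hyperboloid"
  shows "real_hyperbolic_kernel X (\<lambda>x y. lorentz_form (z x) (z y))"
  unfolding real_hyperbolic_kernel_def
proof (intro conjI ballI allI impI)
  fix x y assume "x \<in> X" "y \<in> X"
  then show "0 \<le> lorentz_form (z x) (z y)" "lorentz_form (z x) (z y) = lorentz_form (z y) (z x)"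
    using lorentz_hyperboloid_ge_1[of "z x" "z y"] assms by (auto simp: lorentz_form_commute)
next
  fix x assume "x \<in> X"
  then show "lorentz_form (z x) (z x) = 1" using assms by (auto simp: lorentz_hyperboloid_def)
next
  fix x0 and n :: nat and c :: "nat \<Rightarrow> real" and x
  assume x0: "x0 \<in> X" and "\<forall>j<n. x j \<in> X"
  define m where "m j = z (x j) - lorentz_form (z (x j)) (z x0) *\<^sub>R z x0" for j
  have z0: "lorentz_form (z x0) (z x0) = 1" using assms[OF x0] by (simp add: lorentz_hyperboloid_def)
  define M where "M = (\<Sum>j<n. c j *\<^sub>R m j)"
  have "lorentz_form M (z x0) = 0"
    by (simp add: M_def m_def z0 lorentz_form_sum lorentz_form_simps)
  then have "lorentz_form M M \<le> 0" by (intro lorentz_form_orthogonal_positive(1)) (simp_all add: z0)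
  moreover have "lorentz_form (z (x j)) (z x0) * lorentz_form (z x0) (z (x k))
      - lorentz_form (z (x j)) (z (x k)) = 0 * 0 - 1 * lorentz_form (m j) (m k)" for j k
    by (simp add: m_def z0 lorentz_form_simps lorentz_form_commute[of "z x0" "z (x k)"])
  ultimately show "0 \<le> (\<Sum>j<n. \<Sum>k<n. c j * c k * (lorentz_form (z (x j)) (z x0)
      * lorentz_form (z x0) (z (x k)) - lorentz_form (z (x j)) (z (x k))))"
    unfolding M_def by (simp only: quadratic_form_sum[where P = "\<lambda>_. 0" and s = 1]) simp
qed

text \<open>All claims but the first come from the combination \<open>u\<close> of \<open>x\<close>
  and \<open>y\<close> orthogonal to \<open>l\<close>. The half-sum of ratios is \<open>cosh\<close>
  of the distance between the horospheres at \<open>l\<close> through \<open>x\<close> and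
  \<open>y\<close>; equality means that \<open>x\<close> and \<open>y\<close> lie on one geodesic
  ending at \<open>l\<close>.\<close>

lemma hyperboloid_isotropic_same_sign:
  assumes x: "x \<in> lorentz_hyperboloid" and y: "y \<in> lorentz_hyperboloid"
    and l: "lorentz_form l l = 0" "l \<noteq> 0"
  shows "lorentz_form x l \<noteq> 0"
    and "lorentz_form x l * lorentz_form y l > 0"
    and "(lorentz_form x l / lorentz_form y l + lorentz_form y l / lorentz_form x l) / 2
      \<le> lorentz_form x y"
    and "(lorentz_form x l / lorentz_form y l + lorentz_form y l / lorentz_form x l) / 2
      = lorentz_form x y \<Longrightarrow> \<exists>a b. x = a *\<^sub>R y + b *\<^sub>R l"
proof -
  have nz: "lorentz_form x l \<noteq> 0" if "x \<in> lorentz_hyperboloid" for x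
    using lorentz_form_orthogonal_isotropic(1)[OF l, of x] that by (auto simp: lorentz_hyperboloid_def)
  show "lorentz_form x l \<noteq> 0" by (rule nz[OF x])
  let ?a = "lorentz_form x l" and ?b = "lorentz_form y l" and ?c = "lorentz_form x y"
  have n: "?a \<noteq> 0" "?b \<noteq> 0" using nz x y by blast+
  define u where "u = ?b *\<^sub>R x - ?a *\<^sub>R y"
  have ul: "lorentz_form u l = 0" by (simp add: u_def lorentz_form_simps)
  have uu: "lorentz_form u u = ?b\<^sup>2 + ?a\<^sup>2 - 2 * (?a * ?b) * ?c"
    using x y by (simp add: u_def lorentz_form_simps lorentz_form_commute[of y x]
        lorentz_hyperboloid_def power2_eq_square algebra_simps)
  have le: "?b\<^sup>2 + ?a\<^sup>2 \<le> 2 * (?a * ?b) * ?c"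
    using lorentz_form_orthogonal_isotropic(1)[OF l ul] uu by simp
  have c: "?c \<ge> 1" by (rule lorentz_hyperboloid_ge_1[OF x y])
  have "0 < ?b\<^sup>2 + ?a\<^sup>2" using n by (simp add: sum_power2_gt_zero_iff)
  then have "0 < (?a * ?b) * ?c" using le by linarith
  then show p: "?a * ?b > 0" using c by (simp add: zero_less_mult_iff)
  have f: "(?a / ?b + ?b / ?a) / 2 = (?b\<^sup>2 + ?a\<^sup>2) / (2 * (?a * ?b))"
    using n by (simp add: field_simps power2_eq_square)
  show "(?a / ?b + ?b / ?a) / 2 \<le> ?c"
    unfolding f using p le by (simp only: pos_divide_le_eq) (simp add: mult.commute)
  show "\<exists>a b. x = a *\<^sub>R y + b *\<^sub>R l" if "(?a / ?b + ?b / ?a) / 2 = ?c"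
  proof -
    have "?b\<^sup>2 + ?a\<^sup>2 = ?c * (2 * (?a * ?b))"
      using that n unfolding f by (simp add: divide_eq_eq)
    then have "lorentz_form u u = 0" using uu by simp
    then obtain t where "u = t *\<^sub>R l" using lorentz_form_orthogonal_isotropic(2)[OF l ul] by blast
    then have "?b *\<^sub>R x = ?a *\<^sub>R y + t *\<^sub>R l" by (simp add: u_def algebra_simps)
    then have "(1 / ?b) *\<^sub>R (?b *\<^sub>R x) = (?a / ?b) *\<^sub>R y + (t / ?b) *\<^sub>R l"
      by (simp add: scaleR_add_right)
    then show ?thesis using n by auto
  qed
qed

text \<open>
  In the upper half-space model with \<open>l\<close> at infinity and heights \<open>t = 1 / lorentz_form z l\<close>, this is the
  kernel obtained by scaling the horizontal coordinate by \<open>1 / sqrt 2\<close>.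
\<close>

lemma real_hyperbolic_kernel_contraction:
  assumes z: "\<And>x. x \<in> X \<Longrightarrow> z x \<in> lorentz_hyperboloid"
    and l: "lorentz_form l l = 0" "l \<noteq> 0"
  shows "real_hyperbolic_kernel X (\<lambda>x y. (lorentz_form (z x) (z y)
    + (lorentz_form (z x) l / lorentz_form (z y) l + lorentz_form (z y) l / lorentz_form (z x) l) / 2) / 2)"
    (is "real_hyperbolic_kernel X ?\<beta>")
  unfolding real_hyperbolic_kernel_def
proof (intro conjI ballI allI impI)
  fix x y assume xy: "x \<in> X" "y \<in> X"
  show "?\<beta> x y = ?\<beta> y x" by (simp add: lorentz_form_commute[of "z y" "z x"] add.commute)
  have "lorentz_form (z x) l / lorentz_form (z y) l > 0"
       "lorentz_form (z y) l / lorentz_form (z x) l > 0"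
    using hyperboloid_isotropic_same_sign(2)[OF z[OF xy(1)] z[OF xy(2)] l]
    by (auto simp: zero_less_divide_iff zero_less_mult_iff)
  then show "?\<beta> x y \<ge> 0"
    using lorentz_hyperboloid_ge_1[OF z[OF xy(1)] z[OF xy(2)]] by simp
next
  fix x assume x: "x \<in> X"
  show "?\<beta> x x = 1"
    using z[OF x] hyperboloid_isotropic_same_sign(1)[OF z[OF x] z[OF x] l]
    by (simp add: lorentz_hyperboloid_def)
next
  fix x0 and n :: nat and c :: "nat \<Rightarrow> real" and x
  assume x0: "x0 \<in> X" and x: "\<forall>j<n. x j \<in> X"
  have nz: "lorentz_form (z y) l \<noteq> 0" if "y \<in> X" for y
    using hyperboloid_isotropic_same_sign(1)[OF z[OF that] z[OF that] l] .
  \<comment> \<open>This coefficient makes \<open>m j\<close> orthogonal to \<open>l\<close>, where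
    the form is non-positive.\<close>
  define r where "r j = lorentz_form (z (x j)) l / lorentz_form (z x0) l" for j
  define m where "m j = z (x j) - r j *\<^sub>R z x0" for j
  define P where "P j = ?\<beta> (x j) x0 - r j" for j
  have z0: "lorentz_form (z x0) (z x0) = 1" using z[OF x0] by (simp add: lorentz_hyperboloid_def)
  define M where "M = (\<Sum>j<n. c j *\<^sub>R m j)"
  have "lorentz_form (m j) l = 0" for j
    using nz[OF x0] by (simp add: m_def r_def lorentz_form_simps)
  then have "lorentz_form M l = 0"
    by (simp add: M_def lorentz_form_sum lorentz_form_simps)
  then have M: "lorentz_form M M \<le> 0" by (rule lorentz_form_orthogonal_isotropic(1)[OF l])
  \<comment> \<open>Replacing the product by \<open>P j * P k\<close> releases terms linear in the
    two base-point values. Their ratio terms cancel those of \<open>?\<beta> (x j) (x k)\<close>;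
    what remains is minus half the form of \<open>m j\<close> and \<open>m k\<close>.\<close>
  have eq: "?\<beta> (x j) x0 * ?\<beta> x0 (x k) - ?\<beta> (x j) (x k)
      = P j * P k - 1/2 * lorentz_form (m j) (m k)" if "j < n" "k < n" for j k
  proof -
    have 1: "?\<beta> (x j) x0 = (lorentz_form (z (x j)) (z x0) + (r j + 1 / r j) / 2) / 2"
      "?\<beta> x0 (x k) = (lorentz_form (z (x k)) (z x0) + (r k + 1 / r k) / 2) / 2"
      "?\<beta> (x k) x0 = (lorentz_form (z (x k)) (z x0) + (r k + 1 / r k) / 2) / 2"
      by (simp_all add: r_def lorentz_form_commute[of "z x0" "z (x k)"] add.commute)
    have "?\<beta> (x j) (x k) = (lorentz_form (z (x j)) (z (x k)) + (r j / r k + r k / r j) / 2) / 2"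
      using nz[OF x0] by (simp add: r_def)
    moreover have "lorentz_form (m j) (m k) = lorentz_form (z (x j)) (z (x k))
        - r j * lorentz_form (z (x k)) (z x0) - r k * lorentz_form (z (x j)) (z x0) + r j * r k"
      by (simp add: m_def z0 lorentz_form_simps lorentz_form_commute[of "z x0" "z (x k)"] algebra_simps)
    ultimately show ?thesis
      unfolding P_def 1 by (simp only: divide_inverse) (simp add: algebra_simps)
  qed
  have "(\<Sum>j<n. \<Sum>k<n. c j * c k * (?\<beta> (x j) x0 * ?\<beta> x0 (x k) - ?\<beta> (x j) (x k)))
    = (\<Sum>j<n. \<Sum>k<n. c j * c k * (P j * P k - 1/2 * lorentz_form (m j) (m k)))"
    using eq by (intro sum.cong refl) simp
  also have "\<dots> = (\<Sum>j<n. c j * P j)\<^sup>2 - 1/2 * lorentz_form M M"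
    unfolding M_def by (rule quadratic_form_sum)
  also have "\<dots> \<ge> 0" using M zero_le_power2[of "\<Sum>j<n. c j * P j"] by linarith
  finally show "0 \<le> (\<Sum>j<n. \<Sum>k<n. c j * c k * (?\<beta> (x j) x0 * ?\<beta> x0 (x k) - ?\<beta> (x j) (x k)))" .
qed

lemma real_hyperbolic_kernel_cong:
  assumes "\<And>x y. x \<in> X \<Longrightarrow> y \<in> X \<Longrightarrow> \<beta> x y = \<beta>' x y"
  shows "real_hyperbolic_kernel X \<beta> = real_hyperbolic_kernel X \<beta>'"
proof -
  have "(\<Sum>j<n. \<Sum>k<n. c j * c k * (\<beta> (x j) x0 * \<beta> x0 (x k) - \<beta> (x j) (x k)))
      = (\<Sum>j<n. \<Sum>k<n. c j * c k * (\<beta>' (x j) x0 * \<beta>' x0 (x k) - \<beta>' (x j) (x k)))"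
    if "x0 \<in> X" "\<forall>j<n. x j \<in> X" for n :: nat and c :: "nat \<Rightarrow> real" and x x0
    using that by (intro sum.cong refl) (simp add: assms)
  then show ?thesis
    unfolding real_hyperbolic_kernel_def by (simp add: assms cong: conj_cong)
qed

text \<open>Pairing positively with one point of the upper sheet selects the sheet: otherwise the
  negative of the normalised vector would lie on it and pair with \<open>y\<close> to at least
  1.\<close>

lemma lorentz_hyperboloid_normalize:
  assumes x: "lorentz_form x x > 0" and y: "y \<in> lorentz_hyperboloid" and xy: "lorentz_form x y > 0"
  shows "(1 / sqrt (lorentz_form x x)) *\<^sub>R x \<in> lorentz_hyperboloid"
proof -
  define u where "u = (1 / sqrt (lorentz_form x x)) *\<^sub>R x"
  have u: "lorentz_form u u = 1" "lorentz_form u y > 0"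
    using x xy by (simp_all add: u_def lorentz_form_simps)
  have "fst u \<noteq> 0" using lorentz_positive_norm[of u] u by auto
  moreover have "\<not> fst u < 0"
  proof
    assume "fst u < 0"
    then have "- u \<in> lorentz_hyperboloid" using u by (simp add: lorentz_hyperboloid_def lorentz_form_simps)
    then show False using lorentz_hyperboloid_ge_1[OF _ y, of "- u"] u by (simp add: lorentz_form_simps)
  qed
  ultimately show ?thesis using u by (simp add: lorentz_hyperboloid_def flip: u_def)
qed

text \<open>The difference is isotropic and orthogonal to the positive vector
  \<open>y\<close>.\<close>

lemma lorentz_hyperboloid_eqI:
  assumes "x \<in> lorentz_hyperboloid" "y \<in> lorentz_hyperboloid" "lorentz_form x y = 1"
  shows "x = y"
proof -
  have "lorentz_form (x - y) y = 0" "lorentz_form (x - y) (x - y) = 0" "lorentz_form y y > 0"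
    using assms by (simp_all add: lorentz_form_simps lorentz_form_commute[of y x] lorentz_hyperboloid_def)
  then have "x - y = 0" using lorentz_form_orthogonal_positive(2) by blast
  then show ?thesis by simp
qed

lemma lorentz_hyperboloid_span_inj:
  assumes v: "v \<in> lorentz_hyperboloid" and w: "w \<in> lorentz_hyperboloid" and "span {v} = span {w}"
  shows "v = w"
proof (rule lorentz_hyperboloid_eqI[OF v w])
  have "cosh (hyperbolic_dist (span {v}) (span {w})) = cosh (hyperbolic_dist (span {v}) (span {v}))"
    using assms by simp
  then show "lorentz_form v w = 1"
    using v w by (simp only: cosh_dist_hyperboloid) (simp add: lorentz_hyperboloid_def)
qed

section \<open>Linear actions preserving the hyperboloid\<close>

text \<open>Preserving the upper sheet removes the sign ambiguity of the lifts, which makes an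
  honest linear representation possible.\<close>

locale lorentz_action = group G for G (structure) +
  fixes T :: "'a \<Rightarrow> real \<times> 'h::real_inner \<Rightarrow> real \<times> 'h"
  assumes lorentz: "g \<in> carrier G \<Longrightarrow> T g \<in> lorentz_group"
    and hyperboloid: "g \<in> carrier G \<Longrightarrow> v \<in> lorentz_hyperboloid \<Longrightarrow> T g v \<in> lorentz_hyperboloid"
    and mult: "g \<in> carrier G \<Longrightarrow> h \<in> carrier G \<Longrightarrow> T (g \<otimes> h) x = T g (T h x)"
begin

lemma linear: "g \<in> carrier G \<Longrightarrow> linear (T g)"
  using lorentz by (simp add: lorentz_group_def)

lemma form: "g \<in> carrier G \<Longrightarrow> lorentz_form (T g x) (T g y) = lorentz_form x y"
  using lorentz unfolding lorentz_group_def by blast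

lemma inv_cancel: "g \<in> carrier G \<Longrightarrow> T g (T (inv g) x) = x"
proof -
  assume g: "g \<in> carrier G"
  \<comment> \<open>\<open>T \<one>\<close> is idempotent by multiplicativity and injective, hence
    the identity.\<close>
  have "inj (T \<one>)" using lorentz[of \<one>] by (simp add: lorentz_group_def bij_is_inj)
  moreover have "T \<one> (T \<one> x) = T \<one> x" using mult[of \<one> \<one>] by simp
  ultimately have "T \<one> x = x" by (rule injD)
  then show ?thesis using g mult[of g "inv g" x] by simp
qed

lemma form_inv_mult:
  assumes "g \<in> carrier G" "h \<in> carrier G"
  shows "lorentz_form (T (inv g \<otimes> h) x) y = lorentz_form (T h x) (T g y)"
  using form[OF assms(1), of "T (inv g \<otimes> h) x" y] assms by (simp add: mult inv_cancel)

lemma orbit_function: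
  assumes w: "w \<in> lorentz_hyperboloid"
  shows "real_hyperbolic_function G (\<lambda>g. lorentz_form (T g w) w)"
proof -
  have "real_hyperbolic_kernel (carrier G) (\<lambda>g h. lorentz_form (T g w) (T h w))"
    by (rule real_hyperbolic_kernel_hyperboloid) (rule hyperboloid[OF _ w])
  then show ?thesis
    unfolding real_hyperbolic_function_def
    by (rule real_hyperbolic_kernel_cong[THEN iffD1, rotated])
      (simp add: form_inv_mult, rule lorentz_form_commute)
qed

text \<open>Each \<open>T g\<close> only rescales \<open>l\<close>, so ratios of pairings with
  \<open>l\<close> are unaffected and the contracted kernel is invariant under
  \<open>G\<close>.\<close>

lemma contracted_orbit_function:
  assumes v: "v \<in> lorentz_hyperboloid" and l: "lorentz_form l l = 0" "l \<noteq> 0"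
    and line: "\<And>g. g \<in> carrier G \<Longrightarrow> \<exists>c. T g l = c *\<^sub>R l"
  shows "real_hyperbolic_function G (\<lambda>g. (lorentz_form (T g v) v
    + (lorentz_form (T g v) l / lorentz_form v l + lorentz_form v l / lorentz_form (T g v) l) / 2) / 2)"
proof -
  have "real_hyperbolic_kernel (carrier G) (\<lambda>g h. (lorentz_form (T g v) (T h v)
    + (lorentz_form (T g v) l / lorentz_form (T h v) l
      + lorentz_form (T h v) l / lorentz_form (T g v) l) / 2) / 2)"
    by (rule real_hyperbolic_kernel_contraction[OF _ l]) (rule hyperboloid[OF _ v])
  then show ?thesis
    unfolding real_hyperbolic_function_def
  proof (rule real_hyperbolic_kernel_cong[THEN iffD1, rotated])
    fix g h assume g: "g \<in> carrier G" and h: "h \<in> carrier G"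
    obtain c where c: "T g l = c *\<^sub>R l" using line[OF g] by blast
    have vl: "lorentz_form v l = c * lorentz_form (T g v) l"
      using form[OF g, of v l] by (simp add: c lorentz_form_simps)
    have "c \<noteq> 0" using vl hyperboloid_isotropic_same_sign(1)[OF v v l] by auto
    moreover have "lorentz_form (T (inv g \<otimes> h) v) l = c * lorentz_form (T h v) l"
      by (simp add: form_inv_mult[OF g h] c lorentz_form_simps)
    ultimately show "(lorentz_form (T g v) (T h v)
        + (lorentz_form (T g v) l / lorentz_form (T h v) l
          + lorentz_form (T h v) l / lorentz_form (T g v) l) / 2) / 2
      = (lorentz_form (T (inv g \<otimes> h) v) v + (lorentz_form (T (inv g \<otimes> h) v) l / lorentz_form v l
          + lorentz_form v l / lorentz_form (T (inv g \<otimes> h) v) l) / 2) / 2"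
      by (simp add: vl form_inv_mult[OF g h] lorentz_form_commute[of "T h v" "T g v"])
  qed
qed

lemma invariant_complement:
  assumes "\<And>g x. g \<in> carrier G \<Longrightarrow> x \<in> W \<Longrightarrow> T g x \<in> W"
    and g: "g \<in> carrier G" and x: "x \<in> lorentz_complement W"
  shows "T g x \<in> lorentz_complement W"
  unfolding lorentz_complement_def
proof (intro CollectI ballI)
  fix w assume "w \<in> W"
  then have "lorentz_form x (T (inv g) w) = 0"
    using assms by (simp add: lorentz_complement_def)
  then show "lorentz_form (T g x) w = 0"
    using form[OF g, of x "T (inv g) w"] g by (simp add: inv_cancel)
qed

end

text \<open>\<open>total\<close> is totality of the orbit in linear terms; \<open>minimal\<close> is
  the contrapositive of the hypothesis on unbounded ratios.\<close>

locale minimal_lorentz_action = lorentz_action G T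
  for G (structure) and T :: "'a \<Rightarrow> real \<times> 'h::{real_inner, complete_space} \<Rightarrow> real \<times> 'h" +
  fixes v :: "real \<times> 'h"
  assumes v: "v \<in> lorentz_hyperboloid"
    and total: "\<lbrakk>subspace U; closed U; \<And>g. g \<in> carrier G \<Longrightarrow> T g v \<in> U\<rbrakk> \<Longrightarrow> U = UNIV"
    and minimal: "\<lbrakk>real_hyperbolic_function G F'; \<And>g. g \<in> carrier G \<Longrightarrow> F' g \<le> lorentz_form (T g v) v;
      bounded ((\<lambda>g. lorentz_form (T g v) v / F' g) ` carrier G); g \<in> carrier G\<rbrakk>
      \<Longrightarrow> F' g = lorentz_form (T g v) v"
begin

text \<open>
  If \<open>v = v0 + v1\<close> along \<open>W\<close> and its complement, the comparison function is the one of the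
  projected base point \<open>v0\<close>; the other summand contributes a bounded function.
\<close>

lemma positive_invariant_subspace:
  assumes W: "subspace W" "closed W" and w: "w \<in> W" "lorentz_form w w > 0"
    and inv: "\<And>g x. g \<in> carrier G \<Longrightarrow> x \<in> W \<Longrightarrow> T g x \<in> W"
  shows "W = UNIV"
proof -
  let ?N = "lorentz_complement W"
  have N: "lorentz_form x x \<le> 0" if "x \<in> ?N" for x
    using lorentz_form_orthogonal_positive(1)[OF w(2)] that w(1) by (simp add: lorentz_complement_def)
  obtain v0 where v0: "v0 \<in> W" "v - v0 \<in> ?N" using lorentz_projection[OF W w] by blast
  define v1 where "v1 = v - v0"
  have v1: "v1 \<in> ?N" "v = v0 + v1" using v0 by (simp_all add: v1_def)
  \<comment> \<open>Geometrically, the squared \<open>cosh\<close> of the distance from the base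
    point to its projection \<open>u\<close>.\<close>
  define C where "C = lorentz_form v0 v0"
  have WN: "lorentz_form x y = 0" "lorentz_form y x = 0" if "x \<in> W" "y \<in> ?N" for x y
    using that by (simp_all add: lorentz_complement_def lorentz_form_commute[of x y])
  have "lorentz_form v v = 1" using v by (simp add: lorentz_hyperboloid_def)
  then have C1: "lorentz_form v1 v1 = 1 - C"
    using WN[OF v0(1) v1(1)] by (simp add: v1(2) C_def lorentz_form_simps)
  then have C: "C \<ge> 1" using N[OF v1(1)] by simp
  have "lorentz_form v0 v = C" using WN[OF v0(1) v1(1)] by (simp add: v1(2) C_def lorentz_form_simps)
  define u where "u = (1 / sqrt C) *\<^sub>R v0"
  have u: "u \<in> lorentz_hyperboloid"
    unfolding u_def C_def using lorentz_hyperboloid_normalize[of v0 v] v C \<open>lorentz_form v0 v = C\<close>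
    by (simp add: C_def)
  define F' where "F' g = lorentz_form (T g u) u" for g
  define P where "P g = lorentz_form (T g v1) v1" for g
  have F'1: "F' g \<ge> 1" if "g \<in> carrier G" for g
    unfolding F'_def by (intro lorentz_hyperboloid_ge_1 hyperboloid that u)
  have F: "lorentz_form (T g v) v = C * F' g + P g" if g: "g \<in> carrier G" for g
  proof -
    have "T g v1 \<in> ?N" using invariant_complement[OF inv g v1(1)] .
    then have "lorentz_form (T g v) v = lorentz_form (T g v0) v0 + P g"
      using WN[OF v0(1)] WN[OF inv[OF g v0(1)] v1(1)]
      by (simp add: v1(2) P_def linear_add[OF linear[OF g]] lorentz_form_simps)
    moreover have "F' g = lorentz_form (T g v0) v0 / C"
      using C by (simp add: F'_def u_def linear_scale[OF linear[OF g]] lorentz_form_simps)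
    ultimately show ?thesis using C by simp
  qed
  \<comment> \<open>Cauchy-Schwarz for the non-positive form on \<open>?N\<close>: both
    \<open>T g v1\<close> and \<open>v1\<close> have form \<open>1 - C\<close>.\<close>
  have P: "\<bar>P g\<bar> \<le> C - 1" if g: "g \<in> carrier G" for g
  proof -
    have "T g v1 \<in> ?N" using invariant_complement[OF inv g v1(1)] .
    then have "T g v1 + v1 \<in> ?N" "T g v1 - v1 \<in> ?N"
      using v1(1) by (simp_all add: subspace_add subspace_diff subspace_lorentz_complement)
    then have "lorentz_form (T g v1 + v1) (T g v1 + v1) \<le> 0" "lorentz_form (T g v1 - v1) (T g v1 - v1) \<le> 0"
      using N by blast+
    then show ?thesis
      by (simp add: lorentz_form_simps form[OF g] C1 lorentz_form_commute[of v1 "T g v1"] flip: P_def)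
  qed
  have F'F: "F' g = lorentz_form (T g v) v" if "g \<in> carrier G" for g
  proof (rule minimal[OF _ _ _ that])
    show "real_hyperbolic_function G F'" unfolding F'_def by (rule orbit_function[OF u])
    show "F' g \<le> lorentz_form (T g v) v" if g: "g \<in> carrier G" for g
    proof -
      have "(C - 1) * 1 \<le> (C - 1) * F' g" using C F'1[OF g] by (intro mult_left_mono) auto
      then show ?thesis using P[OF g] unfolding F[OF g] by (simp add: algebra_simps)
    qed
    show "bounded ((\<lambda>g. lorentz_form (T g v) v / F' g) ` carrier G)"
    \<comment> \<open>The bound holds because \<open>P g\<close> is at most \<open>C - 1\<close>,
      hence at most \<open>C * F' g\<close>.\<close>
    proof (rule boundedI[of _ "2 * C"], clarify)
      fix g assume g: "g \<in> carrier G"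
      have "lorentz_form (T g v) v \<ge> 1" by (intro lorentz_hyperboloid_ge_1 hyperboloid g v)
      moreover have "C * 1 \<le> C * F' g" using C F'1[OF g] by (intro mult_left_mono) auto
      then have "lorentz_form (T g v) v \<le> 2 * C * F' g" using P[OF g] unfolding F[OF g] by simp
      ultimately show "norm (lorentz_form (T g v) v / F' g) \<le> 2 * C"
        using F'1[OF g] by (simp add: divide_le_eq)
    qed
  qed
  have "v \<in> W"
  proof (cases "C = 1")
    case True
    then have "v1 = 0"
      using lorentz_form_orthogonal_positive(2)[OF w(2), of v1] C1 WN(2)[OF w(1) v1(1)] by simp
    then show ?thesis using v0(1) v1(2) by simp
  next
    case False
    \<comment> \<open>If \<open>C > 1\<close>, equality of \<open>F'\<close> and \<open>F\<close>
      makes both equal to 1. The orbit is then the single point \<open>v\<close>, and totality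
      leaves only the line of \<open>v\<close>, which contains the vector \<open>w\<close> of
      \<open>W\<close>.\<close>
    have fixed: "T g v = v" if g: "g \<in> carrier G" for g
    proof (rule lorentz_hyperboloid_eqI)
      have "(C - 1) * F' g = - P g" using F[OF g] F'F[OF g] by (simp add: algebra_simps)
      also have "\<dots> \<le> (C - 1) * 1" using P[OF g] by simp
      finally have "F' g \<le> 1" using C False by simp
      then show "lorentz_form (T g v) v = 1" using F'1[OF g] F'F[OF g] by simp
    qed (use hyperboloid g v in auto)
    \<comment> \<open>An equation between continuous maps, which shows that the line is
      closed.\<close>
    have U: "span {v} = {x. x = lorentz_form x v *\<^sub>R v}"
    proof (intro equalityI subsetI)
      fix x assume "x \<in> span {v}"
      then obtain k where "x = k *\<^sub>R v" by (auto simp: span_singleton)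
      then show "x \<in> {x. x = lorentz_form x v *\<^sub>R v}"
        using v by (simp add: lorentz_form_simps lorentz_hyperboloid_def)
    next
      fix x assume "x \<in> {x. x = lorentz_form x v *\<^sub>R v}"
      then have "x = lorentz_form x v *\<^sub>R v" by blast
      then show "x \<in> span {v}" by (metis singletonI span_base span_scale)
    qed
    have "span {v} = UNIV"
    proof (rule total)
      show "closed (span {v})" unfolding U by (intro closed_Collect_eq continuous_intros)
    qed (simp_all add: subspace_span fixed span_base)
    then have wv: "w = lorentz_form w v *\<^sub>R v" using U by blast
    then have "lorentz_form w v \<noteq> 0" using w(2) by (metis lorentz_form_simps(7) less_irrefl scaleR_zero_left)
    then have "v = (1 / lorentz_form w v) *\<^sub>R w" by (subst (2) wv) simp
    then show ?thesis using w(1) W(1) by (metis subspace_scale)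
  qed
  then show ?thesis using W inv total by blast
qed

text \<open>The contracted function \<open>F'\<close> satisfies \<open>F \<le> 2 * F'\<close>, since
  its ratio terms are positive. Minimality then gives the equality case of the horosphere
  inequality, which puts the orbit in the plane of \<open>v\<close> and \<open>l\<close>; totality
  concludes.\<close>

lemma isotropic_invariant_line:
  assumes l: "lorentz_form l l = 0" "l \<noteq> 0"
    and line: "\<And>g. g \<in> carrier G \<Longrightarrow> \<exists>c. T g l = c *\<^sub>R l"
  shows "x \<in> span {v, l}"
proof -
  define F' where "F' g = (lorentz_form (T g v) v
    + (lorentz_form (T g v) l / lorentz_form v l + lorentz_form v l / lorentz_form (T g v) l) / 2) / 2" for g
  have vl: "lorentz_form v l \<noteq> 0" by (rule hyperboloid_isotropic_same_sign(1)[OF v v l])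
  have F'F: "F' g = lorentz_form (T g v) v" if "g \<in> carrier G" for g
  proof (rule minimal[OF _ _ _ that])
    show "real_hyperbolic_function G F'"
      unfolding F'_def by (rule contracted_orbit_function[OF v l line])
    show "F' g \<le> lorentz_form (T g v) v" if g: "g \<in> carrier G" for g
      using hyperboloid_isotropic_same_sign(3)[OF hyperboloid[OF g v] v l] by (simp add: F'_def)
    show "bounded ((\<lambda>g. lorentz_form (T g v) v / F' g) ` carrier G)"
    proof (rule boundedI[of _ 2], clarify)
      fix g assume g: "g \<in> carrier G"
      have 1: "lorentz_form (T g v) v \<ge> 1" by (intro lorentz_hyperboloid_ge_1 hyperboloid g v)
      have "lorentz_form (T g v) l / lorentz_form v l > 0" "lorentz_form v l / lorentz_form (T g v) l > 0"
        using hyperboloid_isotropic_same_sign(2)[OF hyperboloid[OF g v] v l]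
        by (auto simp: zero_less_divide_iff zero_less_mult_iff)
      then have "lorentz_form (T g v) v \<le> 2 * F' g" by (simp add: F'_def)
      then show "norm (lorentz_form (T g v) v / F' g) \<le> 2"
        using 1 by (simp add: divide_le_eq)
    qed
  qed
  \<comment> \<open>A closed equation for that plane: \<open>?p\<close> removes the \<open>v\<close>
    component, and the remaining multiple of \<open>l\<close> is recovered from its pairing with
    \<open>v\<close>.\<close>
  let ?p = "\<lambda>x. x - (lorentz_form x l / lorentz_form v l) *\<^sub>R v"
  let ?U = "{x. ?p x = (lorentz_form (?p x) v / lorentz_form v l) *\<^sub>R l}"
  have U: "?U = span {v, l}"
  proof (intro equalityI subsetI)
    fix x assume "x \<in> ?U"
    then have "?p x = (lorentz_form (?p x) v / lorentz_form v l) *\<^sub>R l" by blast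
    then show "x \<in> span {v, l}" unfolding span_insert[of v] span_singleton by blast
  next
    fix x assume "x \<in> span {v, l}"
    then obtain a b where "x - a *\<^sub>R v = b *\<^sub>R l" by (auto simp: span_insert span_singleton)
    then have "x = a *\<^sub>R v + b *\<^sub>R l" by (metis add.commute diff_add_cancel)
    then show "x \<in> ?U" using l vl by (simp add: lorentz_form_simps lorentz_form_commute[of l v])
  qed
  have "span {v, l} = UNIV"
  proof (rule total)
    show "subspace (span {v, l})" by (rule subspace_span)
    show "closed (span {v, l})"
      unfolding U[symmetric] using vl by (intro closed_Collect_eq continuous_intros) auto
    show "T g v \<in> span {v, l}" if g: "g \<in> carrier G" for g
    proof -
      have "(lorentz_form (T g v) l / lorentz_form v l + lorentz_form v l / lorentz_form (T g v) l) / 2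
        = lorentz_form (T g v) v"
        using F'F[OF g] unfolding F'_def by (simp only: divide_eq_eq_numeral1) simp
      then obtain a b where "T g v = a *\<^sub>R v + b *\<^sub>R l"
        using hyperboloid_isotropic_same_sign(4)[OF hyperboloid[OF g v] v l] by blast
      then show ?thesis by (simp add: span_add span_base span_scale)
    qed
  qed
  then show ?thesis by simp
qed

text \<open>A positive vector in the complement makes the complement everything and \<open>W\<close>
  zero. The isotropic case would confine the space to a plane, whereas \<open>e\<close> and
  \<open>f\<close> give dimension at least three.\<close>

lemma no_invariant_subspace:
  assumes ef: "norm e = 1" "norm f = 1" "inner e (f :: 'h) = 0"
    and W: "subspace W" "closed W" "W \<noteq> {0}"
    and inv: "\<And>g x. g \<in> carrier G \<Longrightarrow> x \<in> W \<Longrightarrow> T g x \<in> W"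
  shows "W = UNIV"
  using W(1,2)
proof (cases rule: closed_subspace_trichotomy)
  case (positive w)
  then show ?thesis using positive_invariant_subspace W inv by blast
next
  case (negative w)
  then have N: "lorentz_complement W = UNIV"
    using positive_invariant_subspace[OF subspace_lorentz_complement closed_lorentz_complement]
      invariant_complement[OF inv] by blast
  have "x = 0" if "x \<in> W" for x
  proof (rule lorentz_form_hyperboloid_cancel)
    fix s
    have "s \<in> lorentz_complement W" using N by simp
    then show "lorentz_form x s = lorentz_form 0 s"
      using that by (simp add: lorentz_complement_def lorentz_form_simps lorentz_form_commute[of x s])
  qed
  then show ?thesis using W subspace_0 by blast
next
  case (isotropic l)
  \<comment> \<open>Non-positivity on \<open>W\<close> at \<open>T g l + l\<close> and
    \<open>T g l - l\<close> forces the isotropic vectors \<open>T g l\<close> and \<open>l\<close>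
    to be orthogonal, hence proportional.\<close>
  have line: "\<exists>c. T g l = c *\<^sub>R l" if g: "g \<in> carrier G" for g
  proof -
    have "T g l + l \<in> W" "T g l - l \<in> W"
      using inv[OF g isotropic(1)] isotropic(1) W(1) by (simp_all add: subspace_add subspace_diff)
    then have "lorentz_form (T g l + l) (T g l + l) \<le> 0" "lorentz_form (T g l - l) (T g l - l) \<le> 0"
      using isotropic(4) by blast+
    then have "lorentz_form (T g l) l = 0"
      by (simp add: lorentz_form_simps form[OF g] isotropic(3) lorentz_form_commute[of l "T g l"])
    moreover have "lorentz_form (T g l) (T g l) = 0" by (simp only: form[OF g] isotropic(3))
    ultimately show ?thesis
      using lorentz_form_orthogonal_isotropic(2)[OF isotropic(3,2)] by blast
  qed
  have "{(1, 0), (0, e), (0, f)} \<subseteq> span {v, l}"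
    by (intro subsetI isotropic_invariant_line[OF isotropic(3,2) line])
  moreover have "independent {(1 :: real, 0), (0, e), (0, f)}"
  proof (rule pairwise_orthogonal_independent)
    show "pairwise orthogonal {(1 :: real, 0), (0, e), (0, f)}"
      using ef by (auto simp: pairwise_insert orthogonal_def inner_commute)
    have "\<forall>x \<in> {(1 :: real, 0), (0, e), (0, f)}. norm x = 1"
      using ef by (simp add: norm_Pair)
    then show "0 \<notin> {(1 :: real, 0), (0, e), (0, f)}"
      by (metis norm_zero zero_neq_one)
  qed
  ultimately have "card {(1 :: real, 0), (0, e), (0, f)} \<le> card {v, l}"
    using independent_span_bound[of "{v, l}" "{(1, 0), (0, e), (0, f)}"]
    by (simp only: finite.intros simp_thms)
  moreover have "card {v, l} \<le> 2" by (simp add: card_insert_if)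
  moreover have "e \<noteq> f" using ef by auto
  then have "card {(1 :: real, 0), (0, e), (0, f)} = 3" by simp
  ultimately show ?thesis by simp
qed

end

section \<open>Lifting isometric actions\<close>

lemma linear_image_line: "linear T \<Longrightarrow> T ` span {v} = span {T v}"
  using linear_span_image[of T "{v}"] by simp

text \<open>Of the two lifts \<open>T\<close> and \<open>-T\<close>, one sends \<open>(1, 0)\<close>
  to the upper sheet; invariance of the form carries the rest of the sheet along.\<close>

lemma lorentz_lift_hyperboloid:
  fixes f :: "(real \<times> 'h::real_inner) set \<Rightarrow> (real \<times> 'h) set"
  assumes "bij_betw f hyperbolic_space hyperbolic_space"
    and "\<And>x y. x \<in> hyperbolic_space \<Longrightarrow> y \<in> hyperbolic_space \<Longrightarrow>
           hyperbolic_dist (f x) (f y) = hyperbolic_dist x y"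
  shows "\<exists>T \<in> lorentz_lifts f. \<forall>w \<in> lorentz_hyperboloid. T w \<in> lorentz_hyperboloid"
proof -
  define e :: "real \<times> 'h" where "e = (1, 0)"
  have e: "e \<in> lorentz_hyperboloid" by (simp add: e_def lorentz_hyperboloid_def lorentz_form_def)
  obtain T where T: "lorentz_lifts f = {T, \<lambda>x. - T x}" using lorentz_lifts_isometry[OF assms] by blast
  then have "T \<in> lorentz_lifts f" by simp
  then have form: "lorentz_form (T x) (T y) = lorentz_form x y" for x y
    unfolding lorentz_lifts_def lorentz_group_def by blast
  have "fst (T e) \<noteq> 0"
    using lorentz_positive_norm[of "T e"] e by (auto simp: form lorentz_hyperboloid_def)
  then have "\<exists>U \<in> lorentz_lifts f. fst (U e) > 0"
    unfolding T by (cases "fst (T e) > 0") auto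
  then obtain U where U: "U \<in> lorentz_lifts f" "fst (U e) > 0" by blast
  then have form: "lorentz_form (U x) (U y) = lorentz_form x y" for x y
    unfolding lorentz_lifts_def lorentz_group_def by blast
  have Ue: "U e \<in> lorentz_hyperboloid" using U e by (simp add: lorentz_hyperboloid_def form)
  have "U w \<in> lorentz_hyperboloid" if w: "w \<in> lorentz_hyperboloid" for w
  proof -
    have "lorentz_form (U w) (U w) = 1" "lorentz_form (U w) (U e) > 0"
      using w lorentz_hyperboloid_ge_1[OF w e] by (simp_all add: form lorentz_hyperboloid_def)
    then show ?thesis using lorentz_hyperboloid_normalize[OF _ Ue, of "U w"] by simp
  qed
  then show ?thesis using U(1) by blast
qed

text \<open>Lifts compose correctly only up to sign. On the upper sheet a point is determined by its
  line, which fixes the sign, and the sheet spans the whole space.\<close>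

lemma isometric_action_lift:
  fixes \<phi> :: "'g \<Rightarrow> (real \<times> 'h::real_inner) set \<Rightarrow> (real \<times> 'h) set"
  assumes \<phi>: "isometric_action G \<phi>"
  obtains T where "lorentz_action G T" "\<And>g. g \<in> carrier G \<Longrightarrow> T g \<in> lorentz_lifts (\<phi> g)"
proof -
  interpret group_action G "hyperbolic_space :: (real \<times> 'h) set set" \<phi>
    using \<phi> by (simp add: isometric_action_def)
  interpret G: group G using group_hom group_hom.axioms(1) by blast
  let ?S = "lorentz_hyperboloid :: (real \<times> 'h) set"
  have "\<exists>T \<in> lorentz_lifts (\<phi> g). \<forall>w \<in> ?S. T w \<in> ?S" if "g \<in> carrier G" for g
    using \<phi> that bij_prop0[OF that]
    by (intro lorentz_lift_hyperboloid) (auto simp: isometric_action_def Bij_def)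
  then obtain T where T: "\<And>g. g \<in> carrier G \<Longrightarrow> T g \<in> lorentz_lifts (\<phi> g)"
    "\<And>g w. g \<in> carrier G \<Longrightarrow> w \<in> ?S \<Longrightarrow> T g w \<in> ?S" by metis
  have lin: "linear (T g)" if "g \<in> carrier G" for g
    using T(1)[OF that] by (simp add: lorentz_lifts_def lorentz_group_def)
  have line: "\<phi> g (span {w}) = span {T g w}" if "g \<in> carrier G" "w \<in> ?S" for g w
    using T(1)[OF that(1)] that(2) linear_image_line[OF lin[OF that(1)]]
    by (auto simp: lorentz_lifts_def hyperbolic_space_hyperboloid)
  have hyp: "T (g \<otimes>\<^bsub>G\<^esub> h) w = T g (T h w)" if gh: "g \<in> carrier G" "h \<in> carrier G" and w: "w \<in> ?S" for g h w
  proof (rule lorentz_hyperboloid_span_inj)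
    have "span {w} \<in> hyperbolic_space" using w by (auto simp: hyperbolic_space_hyperboloid)
    then show "span {T (g \<otimes>\<^bsub>G\<^esub> h) w} = span {T g (T h w)}"
      using composition_rule[of "span {w}" g h] gh w by (simp add: line T(2))
  qed (use gh w T(2) in auto)
  have "lorentz_action G T"
  proof
    fix g h x assume gh: "g \<in> carrier G" "h \<in> carrier G"
    obtain a b v w where "v \<in> ?S" "w \<in> ?S" "x = a *\<^sub>R v + b *\<^sub>R w"
      using lorentz_hyperboloid_spans by blast
    then show "T (g \<otimes>\<^bsub>G\<^esub> h) x = T g (T h x)"
      using gh by (simp add: hyp linear_add[OF lin] linear_scale[OF lin])
  qed (use T in \<open>auto simp: lorentz_lifts_def\<close>)
  then show ?thesis using T(1) that by blast
qed

section \<open>Irreducibility of the corresponding representation\<close>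

theorem proposition1p20:
  fixes G :: "('g, 'm) monoid_scheme"
    and F :: "'g \<Rightarrow> real"
    and \<phi> :: "'g \<Rightarrow> (real \<times> 'h::{real_inner, complete_space}) set \<Rightarrow> (real \<times> 'h) set"
    and p :: "(real \<times> 'h) set"
  assumes "group G"
    and "real_hyperbolic_function G F"
    and "\<And>F'. real_hyperbolic_function G F' \<Longrightarrow> (\<forall>g \<in> carrier G. F' g \<le> F g) \<Longrightarrow>
           (\<exists>g \<in> carrier G. F' g \<noteq> F g) \<Longrightarrow> \<not> bounded ((\<lambda>g. F g / F' g) ` carrier G)"
    and "corresponding_representation G F \<phi> p"
  shows "irreducible_action G \<phi>"
proof -
  have \<phi>: "isometric_action G \<phi>" and p: "p \<in> hyperbolic_space"
    and tot: "total_subset (orbit G \<phi> p)"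
    and F: "\<And>g. g \<in> carrier G \<Longrightarrow> F g = cosh (hyperbolic_dist (\<phi> g p) p)"
    using assms(4) by (auto simp: corresponding_representation_def)
  obtain T where "lorentz_action G T" and lift: "\<And>g. g \<in> carrier G \<Longrightarrow> T g \<in> lorentz_lifts (\<phi> g)"
    using isometric_action_lift[OF \<phi>] by blast
  interpret lorentz_action G T by fact
  obtain v where v: "v \<in> lorentz_hyperboloid" "p = span {v}"
    using p by (auto simp: hyperbolic_space_hyperboloid)
  have act: "\<phi> g x = T g ` x" if "g \<in> carrier G" "x \<in> hyperbolic_space" for g x
    using lift[OF that(1)] that(2) by (simp add: lorentz_lifts_def)
  have \<phi>p: "\<phi> g p = span {T g v}" if "g \<in> carrier G" for g
    using act[OF that p] linear_image_line[OF linear[OF that]] by (simp add: v(2))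
  have F_form: "F g = lorentz_form (T g v) v" if "g \<in> carrier G" for g
    using F[OF that] \<phi>p[OF that] hyperboloid[OF that v(1)] v by (simp add: cosh_dist_hyperboloid)
  have hyp_line: "span {w} \<in> hyperbolic_space" if "w \<in> lorentz_hyperboloid" for w :: "real \<times> 'h"
    using that by (auto simp: hyperbolic_space_hyperboloid)
  have full: "U = UNIV"
    if U: "subspace U" "closed U" "hyperbolic_space \<subseteq> {x \<in> hyperbolic_space. x \<subseteq> U}"
    for U :: "(real \<times> 'h) set"
  proof -
    have mem: "w \<in> U" if "w \<in> lorentz_hyperboloid" for w
      using U(3) hyp_line[OF that] by (auto intro: span_base)
    have "x \<in> U" for x
    proof -
      obtain a b v w where "v \<in> lorentz_hyperboloid" "w \<in> lorentz_hyperboloid" "x = a *\<^sub>R v + b *\<^sub>R w"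
        using lorentz_hyperboloid_spans by blast
      then show ?thesis using mem U(1) by (simp add: subspace_add subspace_scale)
    qed
    then show ?thesis by blast
  qed
  interpret minimal_lorentz_action G T v
  proof
    fix U :: "(real \<times> 'h) set"
    assume U: "subspace U" "closed U" "\<And>g. g \<in> carrier G \<Longrightarrow> T g v \<in> U"
    let ?S = "{x \<in> hyperbolic_space. x \<subseteq> U}"
    have "\<phi> g p \<in> ?S" if "g \<in> carrier G" for g
      using span_minimal[of "{T g v}" U] U that hyp_line hyperboloid[OF that v(1)]
      by (simp add: \<phi>p)
    then have orb: "orbit G \<phi> p \<subseteq> ?S" by (auto simp: orbit_def)
    moreover have "\<phi> \<one>\<^bsub>G\<^esub> p \<in> orbit G \<phi> p" by (auto simp: orbit_def)
    ultimately have "hyperbolic_subspace ?S"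
      using U(1,2) unfolding hyperbolic_subspace_def by blast
    then have "?S = hyperbolic_space" using tot orb unfolding total_subset_def by blast
    then show "U = UNIV" using full U(1,2) by simp
  next
    fix F' g
    assume F': "real_hyperbolic_function G F'"
      "\<And>g. g \<in> carrier G \<Longrightarrow> F' g \<le> lorentz_form (T g v) v"
      "bounded ((\<lambda>g. lorentz_form (T g v) v / F' g) ` carrier G)" and g: "g \<in> carrier G"
    have "(\<lambda>g. F g / F' g) ` carrier G = (\<lambda>g. lorentz_form (T g v) v / F' g) ` carrier G"
      by (intro image_cong refl) (simp add: F_form)
    then have "bounded ((\<lambda>g. F g / F' g) ` carrier G)" using F'(3) by simp
    moreover have "\<forall>g \<in> carrier G. F' g \<le> F g" using F'(2) F_form by simp
    ultimately have "F' g = F g" using assms(3)[OF F'(1)] g by blast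
    then show "F' g = lorentz_form (T g v) v" using F_form[OF g] by simp
  qed (fact v(1))
  show ?thesis
  proof (cases "\<exists>e f :: 'h. norm e = 1 \<and> norm f = 1 \<and> inner e f = 0")
    case True
    then obtain e f :: 'h where ef: "norm e = 1" "norm f = 1" "inner e f = 0" by blast
    have "V = UNIV" if "subspace V" "closed V" "V \<noteq> {0}" "projectively_invariant G \<phi> V" for V
      using that(4) lift by (intro no_invariant_subspace[OF ef that(1-3)])
        (auto simp: projectively_invariant_def)
    then show ?thesis unfolding irreducible_action_def if_P[OF True] by blast
  next
    case False
    have "S = hyperbolic_space"
      if S: "hyperbolic_subspace S" "\<forall>g \<in> carrier G. \<phi> g ` S \<subseteq> S" for S
    proof -
      obtain W where W: "subspace W" "closed W" "S = {x \<in> hyperbolic_space. x \<subseteq> W}" and "S \<noteq> {}"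
        using S(1) by (auto simp: hyperbolic_subspace_def)
      then obtain w where "span {w} \<subseteq> W" and w: "lorentz_form w w > 0"
        by (auto simp: hyperbolic_space_def)
      then have wW: "w \<in> W" by (auto intro: span_base)
      \<comment> \<open>In dimension at most one, invariance is given for \<open>S\<close>, which
        sees only positive vectors of \<open>W\<close>. Adding a suitable multiple of
        \<open>w\<close> then reaches every vector of \<open>W\<close>.\<close>
      have pos: "T g u \<in> W" if g: "g \<in> carrier G" and u: "u \<in> W" "lorentz_form u u > 0" for g u
      proof -
        have "span {u} \<in> hyperbolic_space" using u(2) unfolding hyperbolic_space_def by blast
        moreover from this have "span {u} \<in> S" using u(1) W(1,3) span_minimal[of "{u}" W] by simp
        then have "\<phi> g (span {u}) \<in> S" using S(2) g by blast
        ultimately have "T g ` span {u} \<subseteq> W" using W(3) act[OF g] by simp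
        then show ?thesis by (auto intro: span_base)
      qed
      have "T g u \<in> W" if g: "g \<in> carrier G" and u: "u \<in> W" for g u
      proof -
        obtain c where "lorentz_form (u + c *\<^sub>R w) (u + c *\<^sub>R w) > 0"
          using positive_vectors_span[OF w] by blast
        then have "T g (u + c *\<^sub>R w) - c *\<^sub>R T g w \<in> W"
          using pos[OF g] u w wW W(1) by (simp add: subspace_add subspace_scale subspace_diff)
        then show ?thesis by (simp add: linear_add[OF linear[OF g]] linear_scale[OF linear[OF g]])
      qed
      then have "W = UNIV" using positive_invariant_subspace[OF W(1,2) wW w] by blast
      then show ?thesis using W(3) by simp
    qed
    then show ?thesis unfolding irreducible_action_def if_not_P[OF False] by blast
  qed
qed

end
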